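(* Suppose that $\{S^{\tau(n)}_n:\mathcal{P}_n\to\mathcal{P}_n\}_{n=1}^\infty$ is a sequence of discrete maps that periodically approximates the flow $S^t:X\to X$ (in the sense defined in the context). Then for every fixed $t\in\mathbb{R}$ and every $g\in L^2(X,\mathcal{M},\mu)$, $$\lim_{n\to\infty}\int_{-t}^{t}\left\|\mathcal{U}^{s}g-\mathcal{U}_n^{\xi_n(s)}g_n\right\|^2\,\mathrm{d}s=0,$$ where $g_n=\mathcal{W}_n g$.
   Context: Setting. $X\subseteq\mathbb{R}^N$ is compact, with metric $d$ induced by a norm on $\mathbb{R}^N$. $S^t:X\to X$, $t\in\mathbb{R}$, is a flow: $S^t\circ S^s=S^{t+s}$ and $S^0=\mathrm{id}$. It is Lipschitz continuous: for every $T>0$ the map $(t,x)\mapsto S^t(x)$ is Lipschitz on $[-T,T]\times X$. $\mathcal{M}$ is the Borel sigma-algebra of $X$, and $\mu$ is a finite nonzero Borel measure on $X$, absolutely continuous with respect to Lebesgue measure, with $\operatorname{supp}\mu=X$, and invariant: $\mu(S^t(B))=\mu(B)$ for all $B\in\mathcal{M}$ and $t\in\mathbb{R}$. $\|\cdot\|$ is the norm of $L^2(X,\mathcal{M},\mu)$ (complex-valued functions). The Koopman unitary group is $\mathcal{U}^t g=g\circ S^t$ on $L^2(X,\mathcal{M},\mu)$. Time steps. $\{\tau(n)\}_{n\ge1}$ is a monotonically decreasing sequence of positive reals converging to $0$, and $\xi_n(s)=\operatorname{sign}(s)\lceil |s|/\tau(n)\rceil\tau(n)$ for $s\in\mathbb{R}$.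 Partitions. $\mathcal{P}_n=\{p_{n,1},\dots,p_{n,q(n)}\}$, $n\ge1$, are measurable partitions of $X$ (the elements cover $X$ and distinct elements overlap only in $\mu$-null sets) such that: (i) each $p_{n,j}$ is compact and connected, and $\mu(p_{n,j})=\mu(X)/q(n)$, where $q:\mathbb{N}\to\mathbb{N}$ is strictly increasing; (ii) $\operatorname{diam}(p_{n,j})\le l(n)$, where $l$ is positive, monotone, and tends to $0$; (iii) for $n>m$, each $p_{m,j}$ is a union of elements of $\mathcal{P}_n$. Discrete maps. $S_n^{\tau(n)}:\mathcal{P}_n\to\mathcal{P}_n$ is a bijection of the finite set $\mathcal{P}_n$. For $k\in\mathbb{Z}$, $S_n^{k\tau(n)}$ is its $k$-th iterate, acting elementwise on unions of elements of $\mathcal{P}_n$ (viewed as subsets of $X$). For $A\subseteq X$, $A_n:=\bigcup\{p\in\mathcal{P}_n:p\cap A\ne\emptyset\}$. The sequence $\{S_n^{\tau(n)}\}$ periodically approximates $S^t$ if $$\lim_{n\to\infty}\int_{-t}^{t}d_H\left(S^s(A),S_n^{\xi_n(s)}(A_n)\right)\mathrm{d}s=0$$ for every $t\in\mathbb{R}$ and every nonempty compact $A\subseteq X$, where $d_H$ is the Hausdorff distance. Discrete Koopman operators. $L^2_n(X,\mathcal{M},\mu)$ is the span of the indicator functions $\chi_{p_{n,j}}$, $j=1,\dots,q(n)$. The averaging operator $\mathcal{W}_n:L^2(X,\mathcal{M},\mu)\to L^2_n(X,\mathcal{M},\mu)$ is $\mathcal{W}_ng=g_n=\sum_{j=1}^{q(n)}g_{n,j}\chi_{p_{n,j}}$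 with $g_{n,j}=\frac{q(n)}{\mu(X)}\int_X g\,\chi_{p_{n,j}}\,\mathrm{d}\mu$. For $k\in\mathbb{Z}$, $\mathcal{U}_n^{k\tau(n)}g_n=\sum_{j=1}^{q(n)}g_{n,j}\,\chi_{S_n^{-k\tau(n)}(p_{n,j})}$. $\mathcal{U}_n^{\xi_n(s)}$ means $\mathcal{U}_n^{k\tau(n)}$ with $k\tau(n)=\xi_n(s)$. *)

theory Defs
  imports "HOL-Analysis.Analysis"
begin

section \<open>Metrics induced by a norm\<close>

definition is_norm :: "('a::real_vector \<Rightarrow> real) \<Rightarrow> bool" where
  "is_norm nrm \<longleftrightarrow>
     (\<forall>x. 0 \<le> nrm x) \<and> (\<forall>x. nrm x = 0 \<longleftrightarrow> x = 0) \<and>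
     (\<forall>c x. nrm (c *\<^sub>R x) = \<bar>c\<bar> * nrm x) \<and>
     (\<forall>x y. nrm (x + y) \<le> nrm x + nrm y)"

definition norm_metric :: "('a::real_vector \<Rightarrow> real) \<Rightarrow> 'a metric" where
  "norm_metric nrm = metric (UNIV, \<lambda>x y. nrm (x - y))"

lemma Metric_space_norm:
  assumes "is_norm nrm"
  shows "Metric_space UNIV (\<lambda>x y. nrm (x - y))"
proof
  show "0 \<le> nrm (x - y)" for x y
    using assms by (simp add: is_norm_def)
  show "nrm (x - y) = nrm (y - x)" for x y
  proof -
    have "nrm ((-1) *\<^sub>R (y - x)) = \<bar>-1\<bar> * nrm (y - x)"
      using assms unfolding is_norm_def by blast
    then show ?thesis by simp
  qed
  show "nrm (x - y) = 0 \<longleftrightarrow> x = y" for x y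
    using assms by (simp add: is_norm_def)
  show "nrm (x - z) \<le> nrm (x - y) + nrm (y - z)" for x y z
  proof -
    have "nrm ((x - y) + (y - z)) \<le> nrm (x - y) + nrm (y - z)"
      using assms unfolding is_norm_def by blast
    then show ?thesis by simp
  qed
qed

lemma norm_metric_simps:
  assumes "is_norm nrm"
  shows "mspace (norm_metric nrm) = UNIV"
    and "mdist (norm_metric nrm) = (\<lambda>x y. nrm (x - y))"
  using Metric_space.mspace_metric[OF Metric_space_norm[OF assms]]
    Metric_space.mdist_metric[OF Metric_space_norm[OF assms]]
  by (simp_all add: norm_metric_def)

text \<open>As real suprema and infima, the next two notions are meaningful for nonempty bounded sets,
  the only case used below.\<close>

definition metric_diameter :: "'a metric \<Rightarrow> 'a set \<Rightarrow> real" where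
  "metric_diameter m A = (SUP (x, y) \<in> A \<times> A. mdist m x y)"

definition hausdorff_distance :: "'a metric \<Rightarrow> 'a set \<Rightarrow> 'a set \<Rightarrow> real" where
  "hausdorff_distance m A B =
     max (SUP x\<in>A. INF y\<in>B. mdist m x y) (SUP y\<in>B. INF x\<in>A. mdist m x y)"


section \<open>Measure-preserving Lipschitz flows\<close>

definition measure_support :: "'a::topological_space measure \<Rightarrow> 'a set" where
  "measure_support \<mu> =
     {x \<in> space \<mu>. \<forall>U. open U \<and> x \<in> U \<longrightarrow> emeasure \<mu> (U \<inter> space \<mu>) > 0}"

text \<open>All norms on a finite-dimensional space induce the same topology, so compactness (and
  connectedness) and the Borel sets below are those of the standard topology, while distances
  are those of \<open>nrm\<close>.\<close>

locale measure_preserving_flow = finite_measure \<mu>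
  for \<mu> :: "(real ^ 'n) measure" +
  fixes nrm :: "real ^ 'n \<Rightarrow> real"
    and X :: "(real ^ 'n) set"
    and S :: "real \<Rightarrow> real ^ 'n \<Rightarrow> real ^ 'n"
  assumes norm: "is_norm nrm"
    and compact_X: "compact X"
    and flow_into: "x \<in> X \<Longrightarrow> S t x \<in> X"
    and flow_add: "x \<in> X \<Longrightarrow> S t (S s x) = S (t + s) x"
    and flow_zero: "x \<in> X \<Longrightarrow> S 0 x = x"
    and flow_lipschitz: "T > 0 \<Longrightarrow>
          Lipschitz_continuous_map
            (prod_metric (submetric euclidean_metric {-T..T}) (submetric (norm_metric nrm) X))
            (submetric (norm_metric nrm) X) (\<lambda>(t, x). S t x)"
    and sets_mu: "sets \<mu> = sets (restrict_space borel X)"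
    and mu_nonzero: "emeasure \<mu> X \<noteq> 0"
    and mu_abs_cont: "absolutely_continuous (restrict_space lborel X) \<mu>"
    and mu_support: "measure_support \<mu> = X"
    and mu_invariant: "B \<in> sets \<mu> \<Longrightarrow> emeasure \<mu> (S t ` B) = emeasure \<mu> B"


section \<open>Time steps and partitions\<close>

text \<open>Sequences indexed by \<open>n \<ge> 1\<close> are functions on \<^typ>\<open>nat\<close> whose value at \<open>0\<close> is
  unconstrained.\<close>

definition time_steps :: "(nat \<Rightarrow> real) \<Rightarrow> bool" where
  "time_steps \<tau> \<longleftrightarrow> (\<forall>n\<ge>1. \<tau> n > 0) \<and> antimono_on {1..} \<tau> \<and> \<tau> \<longlonglongrightarrow> 0"

definition xi :: "real \<Rightarrow> real \<Rightarrow> real" where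
  "xi \<delta> s = sgn s * of_int \<lceil>\<bar>s\<bar> / \<delta>\<rceil> * \<delta>"

definition xi_steps :: "real \<Rightarrow> real \<Rightarrow> int" where
  "xi_steps \<delta> s = (THE k. of_int k * \<delta> = xi \<delta> s)"

lemma xi_steps_eq:
  assumes "\<delta> > 0"
  shows "xi_steps \<delta> s = \<lfloor>sgn s\<rfloor> * \<lceil>\<bar>s\<bar> / \<delta>\<rceil>"
    and "of_int (xi_steps \<delta> s) * \<delta> = xi \<delta> s"
proof -
  have eq: "of_int (\<lfloor>sgn s\<rfloor> * \<lceil>\<bar>s\<bar> / \<delta>\<rceil>) * \<delta> = xi \<delta> s"
    by (simp add: xi_def sgn_if)
  have uniq: "k = \<lfloor>sgn s\<rfloor> * \<lceil>\<bar>s\<bar> / \<delta>\<rceil>" if "of_int k * \<delta> = xi \<delta> s" for k :: int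
  proof -
    have "(of_int k :: real) * \<delta> = of_int (\<lfloor>sgn s\<rfloor> * \<lceil>\<bar>s\<bar> / \<delta>\<rceil>) * \<delta>"
      using that eq by simp
    then have "(of_int k :: real) = of_int (\<lfloor>sgn s\<rfloor> * \<lceil>\<bar>s\<bar> / \<delta>\<rceil>)"
      using assms by (metis mult_right_cancel less_irrefl)
    then show ?thesis by (simp only: of_int_eq_iff)
  qed
  show 1: "xi_steps \<delta> s = \<lfloor>sgn s\<rfloor> * \<lceil>\<bar>s\<bar> / \<delta>\<rceil>"
    unfolding xi_steps_def using eq uniq by (rule the_equality)
  show "of_int (xi_steps \<delta> s) * \<delta> = xi \<delta> s"
    unfolding 1 by (rule eq)
qed

text \<open>\<open>X\<close> does not occur as a parameter: it is \<^term>\<open>space \<mu>\<close>.\<close>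

locale partition_sequence =
  fixes m :: "'a::topological_space metric"
    and \<mu> :: "'a measure"
    and P :: "nat \<Rightarrow> 'a set set"
    and q :: "nat \<Rightarrow> nat"
    and l :: "nat \<Rightarrow> real"
  assumes finite_cells: "n \<ge> 1 \<Longrightarrow> finite (P n)"
    and card_cells: "n \<ge> 1 \<Longrightarrow> card (P n) = q n"
    and cells_measurable: "\<lbrakk>n \<ge> 1; p \<in> P n\<rbrakk> \<Longrightarrow> p \<in> sets \<mu>"
    and cells_cover: "n \<ge> 1 \<Longrightarrow> \<Union>(P n) = space \<mu>"
    and cells_overlap: "\<lbrakk>n \<ge> 1; p \<in> P n; p' \<in> P n; p \<noteq> p'\<rbrakk> \<Longrightarrow> p \<inter> p' \<in> null_sets \<mu>"
    and cells_compact: "\<lbrakk>n \<ge> 1; p \<in> P n\<rbrakk> \<Longrightarrow> compact p"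
    and cells_connected: "\<lbrakk>n \<ge> 1; p \<in> P n\<rbrakk> \<Longrightarrow> connected p"
    and cells_measure: "\<lbrakk>n \<ge> 1; p \<in> P n\<rbrakk> \<Longrightarrow> measure \<mu> p = measure \<mu> (space \<mu>) / real (q n)"
    and q_strict_mono: "strict_mono_on {1..} q"
    and cells_diameter: "\<lbrakk>n \<ge> 1; p \<in> P n\<rbrakk> \<Longrightarrow> metric_diameter m p \<le> l n"
    and l_pos: "n \<ge> 1 \<Longrightarrow> l n > 0"
    and l_antimono: "antimono_on {1..} l"
    and l_tendsto: "l \<longlonglongrightarrow> 0"
    and cells_refine: "\<lbrakk>1 \<le> k; k < n; p \<in> P k\<rbrakk> \<Longrightarrow> \<exists>Q\<subseteq>P n. p = \<Union>Q"


section \<open>Discrete maps and periodic approximation\<close>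

definition cell_iterate :: "'a set set \<Rightarrow> ('a set \<Rightarrow> 'a set) \<Rightarrow> int \<Rightarrow> 'a set \<Rightarrow> 'a set" where
  "cell_iterate P F k p =
     (if k \<ge> 0 then (F ^^ nat k) p else (inv_into P F ^^ nat (- k)) p)"

text \<open>The action on a union \<open>B\<close> of cells. Cells have positive measure and null overlaps, so the
  cells contained in \<open>B\<close> are exactly those of which \<open>B\<close> is the union.\<close>

definition union_iterate :: "'a set set \<Rightarrow> ('a set \<Rightarrow> 'a set) \<Rightarrow> int \<Rightarrow> 'a set \<Rightarrow> 'a set" where
  "union_iterate P F k B = \<Union> (cell_iterate P F k ` {p \<in> P. p \<subseteq> B})"

definition outer_cells :: "'a set set \<Rightarrow> 'a set \<Rightarrow> 'a set" where
  "outer_cells P A = \<Union> {p \<in> P. p \<inter> A \<noteq> {}}"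

definition periodically_approximates ::
  "'a::topological_space metric \<Rightarrow> 'a set \<Rightarrow> (real \<Rightarrow> 'a \<Rightarrow> 'a) \<Rightarrow> (nat \<Rightarrow> real) \<Rightarrow>
   (nat \<Rightarrow> 'a set set) \<Rightarrow> (nat \<Rightarrow> 'a set \<Rightarrow> 'a set) \<Rightarrow> bool" where
  "periodically_approximates m X S \<tau> P F \<longleftrightarrow>
     (\<forall>t A. A \<subseteq> X \<and> compact A \<and> A \<noteq> {} \<longrightarrow>
       (\<lambda>n. LBINT s=ereal (-t)..ereal t.
          hausdorff_distance m (S s ` A)
            (union_iterate (P n) (F n) (xi_steps (\<tau> n) s) (outer_cells (P n) A)))
       \<longlonglongrightarrow> 0)"


section \<open>Koopman operators\<close>

text \<open>Elements of \<open>L\<^sup>2\<close> are given by representatives; everything below respects equality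
  almost everywhere.\<close>

definition square_integrable :: "'a measure \<Rightarrow> ('a \<Rightarrow> complex) \<Rightarrow> bool" where
  "square_integrable \<mu> g \<longleftrightarrow>
     g \<in> borel_measurable \<mu> \<and> integrable \<mu> (\<lambda>x. (cmod (g x))\<^sup>2)"

definition L2norm :: "'a measure \<Rightarrow> ('a \<Rightarrow> complex) \<Rightarrow> real" where
  "L2norm \<mu> g = sqrt (LINT x|\<mu>. (cmod (g x))\<^sup>2)"

definition koopman :: "(real \<Rightarrow> 'a \<Rightarrow> 'a) \<Rightarrow> real \<Rightarrow> ('a \<Rightarrow> complex) \<Rightarrow> 'a \<Rightarrow> complex" where
  "koopman S t g = g \<circ> S t"

definition cell_average :: "'a measure \<Rightarrow> nat \<Rightarrow> ('a \<Rightarrow> complex) \<Rightarrow> 'a set \<Rightarrow> complex" where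
  "cell_average \<mu> N g p =
     of_real (real N / measure \<mu> (space \<mu>)) * (LINT x|\<mu>. g x * indicator p x)"

definition averaging ::
  "'a measure \<Rightarrow> 'a set set \<Rightarrow> nat \<Rightarrow> ('a \<Rightarrow> complex) \<Rightarrow> 'a \<Rightarrow> complex" where
  "averaging \<mu> P N g = (\<lambda>x. \<Sum>p\<in>P. cell_average \<mu> N g p * indicator p x)"

text \<open>The operator acts on the span of the indicators of the cells; the coefficients of an
  element of the span are recovered as its cell averages (lemma \<open>discrete_koopman_span\<close>).\<close>

definition discrete_koopman ::
  "'a measure \<Rightarrow> 'a set set \<Rightarrow> ('a set \<Rightarrow> 'a set) \<Rightarrow> nat \<Rightarrow> int \<Rightarrow>
   ('a \<Rightarrow> complex) \<Rightarrow> 'a \<Rightarrow> complex" where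
  "discrete_koopman \<mu> P F N k h =
     (\<lambda>x. \<Sum>p\<in>P. cell_average \<mu> N h p * indicator (cell_iterate P F (- k) p) x)"

lemma (in partition_sequence) cell_average_span:
  assumes "finite_measure \<mu>" "measure \<mu> (space \<mu>) > 0" "n \<ge> 1" and p: "p \<in> P n"
  shows "cell_average \<mu> (q n) (\<lambda>x. \<Sum>p\<in>P n. c p * indicator p x) p = c p"
proof -
  interpret finite_measure \<mu> by fact
  have meas: "r \<in> sets \<mu>" if "r \<in> P n" for r
    using cells_measurable[OF \<open>n \<ge> 1\<close> that] .
  have indic: "(indicator A :: 'a \<Rightarrow> complex) = (\<lambda>x. of_real (indicator A x))" for A :: "'a set"
    by (auto simp: indicator_def)
  have int: "integrable \<mu> (\<lambda>x. indicator (r \<inter> p) x :: complex)" if "r \<in> P n" for r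
    unfolding indic using meas[OF that] meas[OF p]
    by (intro integrable_of_real integrable_real_indicator) (auto simp: top.not_eq_extremum[symmetric])
  have val: "(LINT x|\<mu>. (indicator (r \<inter> p) x :: complex)) = (if r = p then of_real (measure \<mu> p) else 0)"
    if r: "r \<in> P n" for r
  proof -
    have sp: "r \<inter> p \<inter> space \<mu> = r \<inter> p"
      using sets.sets_into_space[OF meas[OF r]] by blast
    have "(LINT x|\<mu>. (indicator (r \<inter> p) x :: complex)) =
        (LINT x|\<mu>. complex_of_real (indicator (r \<inter> p) x))"
      by (intro Bochner_Integration.integral_cong) (auto simp: indicator_def)
    also have "\<dots> = of_real (measure \<mu> (r \<inter> p))"
      by (simp add: sp)
    also have "\<dots> = (if r = p then of_real (measure \<mu> p) else 0)"
      using cells_overlap[OF \<open>n \<ge> 1\<close> r p] by (auto simp: measure_eq_0_null_sets)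
    finally show ?thesis .
  qed
  have "(LINT x|\<mu>. (\<Sum>r\<in>P n. c r * indicator r x) * indicator p x) =
      (LINT x|\<mu>. (\<Sum>r\<in>P n. c r * indicator (r \<inter> p) x))"
    by (simp add: sum_distrib_right mult.assoc indicator_inter_arith)
  also have "\<dots> = (\<Sum>r\<in>P n. c r * (if r = p then of_real (measure \<mu> p) else 0))"
    using int val by (subst Bochner_Integration.integral_sum) (auto intro!: sum.cong)
  also have "\<dots> = c p * of_real (measure \<mu> p)"
    using p finite_cells[OF \<open>n \<ge> 1\<close>] by (simp add: if_distrib sum.delta' cong: if_cong)
  finally have *: "(LINT x|\<mu>. (\<Sum>r\<in>P n. c r * indicator r x) * indicator p x) =
      c p * of_real (measure \<mu> p)" .
  have "q n > 0"
    using card_cells[OF \<open>n \<ge> 1\<close>] p finite_cells[OF \<open>n \<ge> 1\<close>] card_gt_0_iff by fastforce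
  then have "real (q n) / measure \<mu> (space \<mu>) * measure \<mu> p = 1"
    using assms(2) cells_measure[OF \<open>n \<ge> 1\<close> p] by simp
  then have "complex_of_real (real (q n) / measure \<mu> (space \<mu>)) * of_real (measure \<mu> p) = 1"
    by (metis of_real_1 of_real_mult)
  then show ?thesis
    unfolding cell_average_def * by (metis mult.left_commute mult.right_neutral)
qed

lemma (in partition_sequence) discrete_koopman_span:
  assumes "finite_measure \<mu>" "measure \<mu> (space \<mu>) > 0" "n \<ge> 1"
  shows "discrete_koopman \<mu> (P n) (F n) (q n) k (\<lambda>x. \<Sum>p\<in>P n. c p * indicator p x) =
    (\<lambda>x. \<Sum>p\<in>P n. c p * indicator (cell_iterate (P n) (F n) (- k) p) x)"
  using cell_average_span[OF assms] by (auto simp: discrete_koopman_def intro!: sum.cong)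

end

theory Submission
  imports Defs
begin

text \<open>Call \<open>g\<close> controlled if the error \<open>\<parallel>U\<^sup>s g - U\<^sub>n g\<^sub>n\<parallel>\<^sup>2\<close> is small, uniformly in \<open>n\<close> and \<open>\<bar>s\<bar> \<le> T\<close>,
  as soon as finitely many of the Hausdorff distances \<open>d\<^sub>H(S\<^sup>-\<^sup>s A, S\<^sub>n A\<^sub>n)\<close> are small. Since all operators
  involved are \<open>L\<^sup>2\<close>-contractions, controlled functions form a closed subspace. The indicator of a
  compact set \<open>K\<close> is controlled: if the transported cells lie in a small neighbourhood of
  \<open>D = S\<^sup>-\<^sup>s K\<close>, then by the Lipschitz continuity and invariance little of the transported mass lies
  outside \<open>D\<close>, and as the total transported mass is \<open>\<mu> K = \<mu> D\<close>, equally little of \<open>D\<close> is missed.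
  By inner regularity every \<open>L\<^sup>2\<close> function is controlled. The error being bounded, it is at most
  \<open>\<epsilon>\<close> plus a constant times the sum of these distances, whose integrals over time tend to \<open>0\<close>.\<close>

section \<open>Square-integrable functions\<close>

lemma L2norm_power2: "(L2norm \<mu> g)\<^sup>2 = (LINT x|\<mu>. (cmod (g x))\<^sup>2)"
  by (simp add: L2norm_def Bochner_Integration.integral_nonneg)

lemma L2norm_cong: "(\<And>x. x \<in> space \<mu> \<Longrightarrow> f x = g x) \<Longrightarrow> L2norm \<mu> f = L2norm \<mu> g"
  unfolding L2norm_def by (auto cong: Bochner_Integration.integral_cong)

lemma L2norm_cmult_power2: "(L2norm \<mu> (\<lambda>x. c * g x))\<^sup>2 = (cmod c)\<^sup>2 * (L2norm \<mu> g)\<^sup>2"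
  by (simp add: L2norm_power2 norm_mult power_mult_distrib)

lemma cmod_add_power2_le: "(cmod (a + b))\<^sup>2 \<le> 2 * (cmod a)\<^sup>2 + 2 * (cmod b)\<^sup>2"
proof -
  have "(cmod (a + b))\<^sup>2 \<le> (cmod a + cmod b)\<^sup>2"
    by (intro power_mono norm_triangle_ineq) auto
  also have "\<dots> \<le> 2 * (cmod a)\<^sup>2 + 2 * (cmod b)\<^sup>2"
    using sum_squares_bound[of "cmod a" "cmod b"] by (simp add: power2_sum)
  finally show ?thesis .
qed

lemma square_integrable_add:
  assumes "square_integrable \<mu> f" "square_integrable \<mu> g"
  shows "square_integrable \<mu> (\<lambda>x. f x + g x)"
  unfolding square_integrable_def
proof
  have [measurable]: "f \<in> borel_measurable \<mu>" "g \<in> borel_measurable \<mu>"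
    using assms by (auto simp: square_integrable_def)
  show "(\<lambda>x. f x + g x) \<in> borel_measurable \<mu>" by measurable
  show "integrable \<mu> (\<lambda>x. (cmod (f x + g x))\<^sup>2)"
    by (rule Bochner_Integration.integrable_bound[of _ "\<lambda>x. 2 * (cmod (f x))\<^sup>2 + 2 * (cmod (g x))\<^sup>2"])
      (use assms cmod_add_power2_le in \<open>auto simp: square_integrable_def\<close>)
qed

lemma square_integrable_cmult:
  "square_integrable \<mu> g \<Longrightarrow> square_integrable \<mu> (\<lambda>x. c * g x)"
  by (auto simp: square_integrable_def norm_mult power_mult_distrib)

lemma square_integrable_diff:
  assumes "square_integrable \<mu> f" "square_integrable \<mu> g"
  shows "square_integrable \<mu> (\<lambda>x. f x - g x)"
  using square_integrable_add[OF assms(1) square_integrable_cmult[OF assms(2), of "-1"]] by simp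

lemma L2norm_add_power2_le:
  assumes "square_integrable \<mu> f" "square_integrable \<mu> g"
  shows "(L2norm \<mu> (\<lambda>x. f x + g x))\<^sup>2 \<le> 2 * (L2norm \<mu> f)\<^sup>2 + 2 * (L2norm \<mu> g)\<^sup>2"
proof -
  have "(LINT x|\<mu>. (cmod (f x + g x))\<^sup>2) \<le> (LINT x|\<mu>. 2 * (cmod (f x))\<^sup>2 + 2 * (cmod (g x))\<^sup>2)"
    using assms square_integrable_add[OF assms] cmod_add_power2_le
    by (intro integral_mono) (auto simp: square_integrable_def)
  then show ?thesis
    using assms by (simp add: L2norm_power2 square_integrable_def)
qed

lemma L2norm_diff_power2_le:
  assumes "square_integrable \<mu> f" "square_integrable \<mu> g"
  shows "(L2norm \<mu> (\<lambda>x. f x - g x))\<^sup>2 \<le> 2 * (L2norm \<mu> f)\<^sup>2 + 2 * (L2norm \<mu> g)\<^sup>2"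
  using L2norm_add_power2_le[OF assms(1) square_integrable_cmult[OF assms(2), of "-1"]]
  by (simp add: L2norm_cmult_power2[of _ "-1", simplified])

lemma (in finite_measure) square_integrable_simple_function:
  assumes "simple_function M (g :: _ \<Rightarrow> complex)"
  shows "square_integrable M g"
proof -
  have "simple_function M (\<lambda>x. (cmod (g x))\<^sup>2)"
    using simple_function_compose[OF assms, of "\<lambda>z. (cmod z)\<^sup>2"] by (simp add: o_def)
  then have "integrable M (\<lambda>x. (cmod (g x))\<^sup>2)"
    by (intro integrable_simple_function) (auto simp: emeasure_eq_measure)
  with borel_measurable_simple_function[OF assms] show ?thesis
    by (simp add: square_integrable_def)
qed

lemma (in finite_measure) square_integrable_indicator:
  "A \<in> sets M \<Longrightarrow> square_integrable M (indicator A)"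
  by (intro square_integrable_simple_function simple_function_indicator)

lemma (in finite_measure) integrable_of_square_integrable:
  assumes "square_integrable M g"
  shows "integrable M g"
proof (rule Bochner_Integration.integrable_bound[of _ "\<lambda>x. 1 + (cmod (g x))\<^sup>2"])
  \<comment> \<open>The constant in the dominating function is integrable because the measure is
    finite.\<close>
  show "integrable M (\<lambda>x. 1 + (cmod (g x))\<^sup>2)" and "g \<in> borel_measurable M"
    using assms by (auto simp: square_integrable_def)
  have "y \<le> 1 + y\<^sup>2" for y :: real
  proof -
    have "2 * y \<le> 1 + y\<^sup>2" using sum_squares_bound[of 1 y] by simp
    then show ?thesis using zero_le_power2[of y] by linarith
  qed
  then show "AE x in M. norm (g x) \<le> norm (1 + (cmod (g x))\<^sup>2)" by auto
qed

lemma (in finite_measure) integrable_times_indicator: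
  assumes "square_integrable M g" "A \<in> sets M"
  shows "integrable M (\<lambda>x. g x * indicator A x)"
proof -
  have "integrable M (\<lambda>x. indicator A x *\<^sub>R g x)"
    using integrable_mult_indicator[OF assms(2) integrable_of_square_integrable[OF assms(1)]] .
  also have "(\<lambda>x. indicator A x *\<^sub>R g x) = (\<lambda>x. g x * indicator A x)"
    by (auto simp: indicator_def)
  finally show ?thesis .
qed


section \<open>Equimeasurable partitions\<close>

text \<open>With cell averages as coefficients this is the averaged function when \<open>T\<close>
  is the identity, and its image under a discrete Koopman operator when \<open>T\<close> is an
  iterate of the cell map.\<close>

definition step_function ::
  "'a set set \<Rightarrow> ('a set \<Rightarrow> 'a set) \<Rightarrow> ('a set \<Rightarrow> complex) \<Rightarrow> 'a \<Rightarrow> complex" where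
  "step_function P T c = (\<lambda>x. \<Sum>p\<in>P. c p * indicator (T p) x)"

text \<open>A single level of \<open>partition_sequence\<close>, free of topology and diameters: the
  estimates on one level rest on equal masses, covering and null overlaps.\<close>

locale equal_partition = finite_measure \<mu> for \<mu> :: "'a measure" +
  fixes P :: "'a set set" and N :: nat
  assumes finite_P: "finite P"
    and sets_P: "p \<in> P \<Longrightarrow> p \<in> sets \<mu>"
    and cover_P: "\<Union>P = space \<mu>"
    and overlap_P: "\<lbrakk>p \<in> P; p' \<in> P; p \<noteq> p'\<rbrakk> \<Longrightarrow> p \<inter> p' \<in> null_sets \<mu>"
    and measure_P: "p \<in> P \<Longrightarrow> measure \<mu> p = measure \<mu> (space \<mu>) / real N"
    and N_pos: "N > 0"
    and space_pos: "measure \<mu> (space \<mu>) > 0"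
begin

abbreviation "avg \<equiv> cell_average \<mu> N"

lemma measure_P_pos: "p \<in> P \<Longrightarrow> measure \<mu> p > 0"
  using N_pos space_pos by (simp add: measure_P)

lemma avg_eq: "p \<in> P \<Longrightarrow> avg g p = (LINT x|\<mu>. g x * indicator p x) / of_real (measure \<mu> p)"
  using N_pos space_pos by (simp add: cell_average_def measure_P field_simps)

text \<open>The overlaps of finitely many cells form a null set. Off it a point lies in a single
  cell \<open>r\<close>, and the permutation \<open>T\<close> has exactly one index \<open>p\<close>
  with \<open>T p = r\<close>.\<close>

lemma AE_unique_cell:
  assumes T: "bij_betw T P P"
  shows "AE x in \<mu>. \<exists>p\<in>P. \<forall>p'\<in>P. x \<in> T p' \<longleftrightarrow> p' = p"
proof -
  define Z where "Z = (\<Union>(p, p')\<in>{(p, p') \<in> P \<times> P. p \<noteq> p'}. p \<inter> p')"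
  have "Z \<in> null_sets \<mu>"
    unfolding Z_def
    by (rule null_sets_UN')
      (auto intro!: countable_finite finite_subset[OF _ finite_cartesian_product[OF finite_P finite_P]] overlap_P)
  then have "AE x in \<mu>. x \<notin> Z" by (rule AE_not_in)
  moreover have "AE x in \<mu>. x \<in> space \<mu>" by (rule AE_space)
  ultimately show ?thesis
  proof eventually_elim
    case (elim x)
    then obtain r where r: "r \<in> P" "x \<in> r" using cover_P by auto
    then obtain p where p: "p \<in> P" "T p = r"
      using bij_betw_imp_surj_on[OF T] by (metis imageE)
    have "p' = p" if "p' \<in> P" "x \<in> T p'" for p'
    proof -
      have "T p' \<in> P" using T that by (auto simp: bij_betw_def)
      then have "T p' = r" using elim r that by (auto simp: Z_def)
      with p that T show ?thesis by (auto simp: bij_betw_def inj_on_def)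
    qed
    with p r show ?case by auto
  qed
qed

lemma sum_unique_cell:
  fixes c :: "'a set \<Rightarrow> 'b::comm_semiring_1"
  assumes "p \<in> P" "\<forall>p'\<in>P. x \<in> T p' \<longleftrightarrow> p' = p"
  shows "(\<Sum>p\<in>P. c p * indicator (T p) x) = c p"
proof -
  have "(\<Sum>p\<in>P. c p * indicator (T p) x) = (\<Sum>p'\<in>P. if p' = p then c p' else 0)"
    using assms by (intro sum.cong) (auto simp: indicator_def)
  then show ?thesis using assms finite_P by simp
qed

lemma sets_moved: "bij_betw T P P \<Longrightarrow> p \<in> P \<Longrightarrow> T p \<in> sets \<mu>"
  using sets_P by (auto simp: bij_betw_def)

lemma measure_moved: "bij_betw T P P \<Longrightarrow> p \<in> P \<Longrightarrow> measure \<mu> (T p) = measure \<mu> p"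
  using measure_P by (metis bij_betwE)

lemma integrable_indicator_cell:
  "bij_betw T P P \<Longrightarrow> p \<in> P \<Longrightarrow> integrable \<mu> (indicator (T p) :: 'a \<Rightarrow> real)"
  using sets_moved by (auto simp: top.not_eq_extremum[symmetric])

lemma step_function_measurable [measurable]:
  assumes "bij_betw T P P"
  shows "step_function P T c \<in> borel_measurable \<mu>"
  unfolding step_function_def using sets_moved[OF assms] by measurable

text \<open>Almost every point meets only one summand, so the cross terms of the square
  vanish.\<close>

lemma step_function_AE:
  assumes "bij_betw T P P"
  shows "AE x in \<mu>. (cmod (step_function P T c x))\<^sup>2 = (\<Sum>p\<in>P. (cmod (c p))\<^sup>2 * indicator (T p) x)"
  using AE_unique_cell[OF assms]
proof eventually_elim
  case (elim x)
  then obtain p where p: "p \<in> P" "\<forall>p'\<in>P. x \<in> T p' \<longleftrightarrow> p' = p" by blast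
  show ?case unfolding step_function_def sum_unique_cell[OF p] ..
qed

lemma integrable_moved_sum:
  assumes "bij_betw T P P"
  shows "integrable \<mu> (\<lambda>x. \<Sum>p\<in>P. (c p :: real) * indicator (T p) x)"
  using integrable_indicator_cell[OF assms] by auto

text \<open>The value is independent of \<open>T\<close>, since \<open>T\<close> permutes cells of
  equal measure.\<close>

lemma integral_moved_sum:
  assumes T: "bij_betw T P P"
  shows "(LINT x|\<mu>. (\<Sum>p\<in>P. (c p :: real) * indicator (T p) x)) = (\<Sum>p\<in>P. c p * measure \<mu> p)"
proof -
  have sp: "T p \<inter> space \<mu> = T p" if "p \<in> P" for p
    using sets.sets_into_space[OF sets_moved[OF T that]] by blast
  show ?thesis
    using integrable_indicator_cell[OF T] measure_moved[OF T] sp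
    by (subst Bochner_Integration.integral_sum) (auto intro!: sum.cong)
qed

lemma sum_integral_cells:
  fixes f :: "'a \<Rightarrow> real"
  assumes f: "integrable \<mu> f"
  shows "(\<Sum>p\<in>P. (LINT x|\<mu>. f x * indicator p x)) = (LINT x|\<mu>. f x)"
proof -
  have int: "integrable \<mu> (\<lambda>x. f x * indicator p x)" if "p \<in> P" for p
    using integrable_mult_indicator[OF sets_P[OF that] f] by (simp add: mult.commute)
  have "(\<Sum>p\<in>P. (LINT x|\<mu>. f x * indicator p x)) = (LINT x|\<mu>. (\<Sum>p\<in>P. f x * indicator p x))"
    using int by (subst Bochner_Integration.integral_sum) auto
  also have "\<dots> = (LINT x|\<mu>. f x)"
  proof (rule integral_cong_AE)
    show "AE x in \<mu>. (\<Sum>p\<in>P. f x * indicator p x) = f x"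
      using AE_unique_cell[OF bij_betw_id]
    proof eventually_elim
      case (elim x)
      then obtain p where p: "p \<in> P" "\<forall>p'\<in>P. x \<in> id p' \<longleftrightarrow> p' = p" by blast
      show ?case using sum_unique_cell[where T = id and c = "\<lambda>_. f x", OF p] by simp
    qed
    show "(\<lambda>x. \<Sum>p\<in>P. f x * indicator p x) \<in> borel_measurable \<mu>"
      using borel_measurable_integrable[OF f] sets_P by measurable
  qed (use f in auto)
  finally show ?thesis .
qed

text \<open>Jensen's inequality on one cell, by integrating the tangent bound
  \<open>2 * a * y - a\<^sup>2 \<le> y\<^sup>2\<close> for \<open>y = cmod (g x)\<close>, where
  \<open>a\<close> is the mean of \<open>cmod (g x)\<close> over the cell.\<close>

lemma avg_power2_le:
  assumes g: "square_integrable \<mu> g" and p: "p \<in> P"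
  shows "(cmod (avg g p))\<^sup>2 * measure \<mu> p \<le> (LINT x|\<mu>. (cmod (g x))\<^sup>2 * indicator p x)"
proof -
  define I where "I = (LINT x|\<mu>. cmod (g x) * indicator p x)"
  define a where "a = I / measure \<mu> p"
  have pos: "measure \<mu> p > 0" using measure_P_pos[OF p] .
  have [measurable]: "p \<in> sets \<mu>" using sets_P[OF p] .
  have norm_ind: "cmod (indicator p x) = indicator p x" for x by (simp add: indicator_def)
  have int1: "integrable \<mu> (\<lambda>x. cmod (g x) * indicator p x)"
    using integrable_norm[OF integrable_times_indicator[OF g sets_P[OF p]]]
    by (simp add: norm_mult norm_ind)
  have int2: "integrable \<mu> (\<lambda>x. (cmod (g x))\<^sup>2 * indicator p x)"
    using integrable_mult_indicator[OF sets_P[OF p], of "\<lambda>x. (cmod (g x))\<^sup>2"] g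
    by (simp add: mult.commute square_integrable_def)
  have int3: "integrable \<mu> (indicator p :: 'a \<Rightarrow> real)"
    using integrable_indicator_cell[OF bij_betw_id p] by simp
  have "cmod (LINT x|\<mu>. g x * indicator p x) \<le> (LINT x|\<mu>. cmod (g x * indicator p x))"
    by (rule integral_norm_bound)
  then have "cmod (avg g p) \<le> a"
    using pos p unfolding avg_eq[OF p] a_def I_def
    by (simp add: norm_divide norm_mult norm_ind divide_right_mono)
  then have "(cmod (avg g p))\<^sup>2 * measure \<mu> p \<le> a\<^sup>2 * measure \<mu> p"
    using pos by (intro mult_right_mono power_mono) auto
  \<comment> \<open>As \<open>I = a * measure \<mu> p\<close>, this is the same number in a form
    linear in \<open>I\<close>, that is, the integral of the tangent line.\<close>
  also have "\<dots> = 2 * a * I - a\<^sup>2 * measure \<mu> p"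
    using pos by (simp add: a_def power2_eq_square field_simps)
  also have "\<dots> = (LINT x|\<mu>. 2 * a * (cmod (g x) * indicator p x) - a\<^sup>2 * indicator p x)"
  proof -
    have "p \<inter> space \<mu> = p" using sets.sets_into_space[OF sets_P[OF p]] by blast
    then show ?thesis using int1 int3 by (simp add: I_def)
  qed
  also have "\<dots> \<le> (LINT x|\<mu>. (cmod (g x))\<^sup>2 * indicator p x)"
  proof (rule integral_mono)
    fix x
    have "0 \<le> (cmod (g x) - a)\<^sup>2" by simp
    then show "2 * a * (cmod (g x) * indicator p x) - a\<^sup>2 * indicator p x \<le> (cmod (g x))\<^sup>2 * indicator p x"
      by (auto simp: indicator_def power2_diff algebra_simps)
  qed (use int1 int2 int3 in auto)
  finally show ?thesis .
qed

text \<open>Averaging contracts on each cell by \<open>avg_power2_le\<close>, and moving the cells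
  keeps the norm because their masses agree.\<close>

lemma L2norm_step_function_avg_le:
  assumes T: "bij_betw T P P" and g: "square_integrable \<mu> g"
  shows "square_integrable \<mu> (step_function P T (avg g))"
    and "(L2norm \<mu> (step_function P T (avg g)))\<^sup>2 \<le> (L2norm \<mu> g)\<^sup>2"
proof -
  note AE = step_function_AE[OF T, of "avg g"]
  have int: "integrable \<mu> (\<lambda>x. \<Sum>p\<in>P. (cmod (avg g p))\<^sup>2 * indicator (T p) x)"
    by (rule integrable_moved_sum[OF T])
  have [measurable]: "step_function P T (avg g) \<in> borel_measurable \<mu>"
    by (rule step_function_measurable[OF T])
  then have "integrable \<mu> (\<lambda>x. (cmod (step_function P T (avg g) x))\<^sup>2)"
    using int by (subst integrable_cong_AE[OF _ _ AE]) auto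
  then show "square_integrable \<mu> (step_function P T (avg g))"
    by (simp add: square_integrable_def)
  have "(L2norm \<mu> (step_function P T (avg g)))\<^sup>2 = (LINT x|\<mu>. (\<Sum>p\<in>P. (cmod (avg g p))\<^sup>2 * indicator (T p) x))"
    unfolding L2norm_power2 using int by (intro integral_cong_AE AE) auto
  also have "\<dots> = (\<Sum>p\<in>P. (cmod (avg g p))\<^sup>2 * measure \<mu> p)"
    by (rule integral_moved_sum[OF T])
  also have "\<dots> \<le> (\<Sum>p\<in>P. (LINT x|\<mu>. (cmod (g x))\<^sup>2 * indicator p x))"
    by (intro sum_mono avg_power2_le g)
  also have "\<dots> = (L2norm \<mu> g)\<^sup>2"
    using g by (simp add: sum_integral_cells L2norm_power2 square_integrable_def)
  finally show "(L2norm \<mu> (step_function P T (avg g)))\<^sup>2 \<le> (L2norm \<mu> g)\<^sup>2" .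
qed

lemma step_function_avg_add:
  assumes "square_integrable \<mu> f" "square_integrable \<mu> g"
  shows "step_function P T (avg (\<lambda>x. f x + g x)) x = step_function P T (avg f) x + step_function P T (avg g) x"
proof -
  have "avg (\<lambda>x. f x + g x) p = avg f p + avg g p" if "p \<in> P" for p
    using integrable_times_indicator[OF assms(1) sets_P[OF that]]
      integrable_times_indicator[OF assms(2) sets_P[OF that]]
    by (simp add: cell_average_def distrib_right ring_distribs)
  then show ?thesis
    by (simp add: step_function_def distrib_right sum.distrib)
qed

lemma step_function_avg_cmult:
  "step_function P T (avg (\<lambda>x. c * g x)) x = c * step_function P T (avg g) x"
  by (simp add: step_function_def cell_average_def sum_distrib_left mult_ac)

text \<open>As \<open>D\<close> and \<open>K\<close> have the same measure, the transported averages of \<open>indicator K\<close> have the same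
  integral as \<open>indicator D\<close>; hence the mass missing on \<open>D\<close> equals the mass outside \<open>D\<close>.\<close>

lemma L2norm_indicator_step_function_le:
  assumes T: "bij_betw T P P" and K: "K \<in> sets \<mu>" and D: "D \<in> sets \<mu>"
    and eq: "measure \<mu> D = measure \<mu> K"
    and E: "E \<in> sets \<mu>" "\<And>p. p \<in> P \<Longrightarrow> p \<inter> K \<noteq> {} \<Longrightarrow> T p - D \<subseteq> E"
  shows "(L2norm \<mu> (\<lambda>x. indicator D x - step_function P T (avg (indicator K)) x))\<^sup>2 \<le> 2 * measure \<mu> E"
proof -
  \<comment> \<open>\<open>a p\<close> is the fraction of the cell \<open>p\<close> filled by
    \<open>K\<close>, and \<open>w\<close> is the step function regarded as real valued.\<close>
  define a where "a p = measure \<mu> (K \<inter> p) / measure \<mu> p" for p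
  define w where "w x = (\<Sum>p\<in>P. a p * indicator (T p) x)" for x
  have avg: "avg (indicator K) p = of_real (a p)" if p: "p \<in> P" for p
  proof -
    have "K \<inter> p \<inter> space \<mu> = K \<inter> p"
      using sets.sets_into_space[OF K] by blast
    moreover have "(LINT x|\<mu>. indicator K x * indicator p x :: complex) =
        (LINT x|\<mu>. complex_of_real (indicator (K \<inter> p) x))"
      by (intro Bochner_Integration.integral_cong) (auto simp: indicator_def)
    ultimately show ?thesis by (simp add: avg_eq[OF p] a_def)
  qed
  have a01: "0 \<le> a p" "a p \<le> 1" if "p \<in> P" for p
    using measure_P_pos[OF that] finite_measure_mono[of "K \<inter> p" p] sets_P[OF that]
    by (auto simp: a_def)
  have a0: "a p = 0" if "p \<inter> K = {}" for p
    using that by (simp add: a_def Int_commute)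
  have step: "step_function P T (avg (indicator K)) x = of_real (w x)" for x
    unfolding step_function_def w_def of_real_sum
    by (intro sum.cong) (auto simp: avg indicator_def)
  have w_int: "integrable \<mu> w"
    unfolding w_def by (rule integrable_moved_sum[OF T])
  have "(LINT x|\<mu>. w x) = (\<Sum>p\<in>P. a p * measure \<mu> p)"
    unfolding w_def by (rule integral_moved_sum[OF T])
  also have "\<dots> = (\<Sum>p\<in>P. (LINT x|\<mu>. indicator K x * indicator p x))"
  proof (rule sum.cong)
    fix p assume p: "p \<in> P"
    have "K \<inter> p \<inter> space \<mu> = K \<inter> p"
      using sets.sets_into_space[OF K] by blast
    then show "a p * measure \<mu> p = (LINT x|\<mu>. indicator K x * indicator p x)"
      using measure_P_pos[OF p] by (simp add: a_def indicator_inter_arith[symmetric])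
  qed simp
  also have "\<dots> = (LINT x|\<mu>. indicator K x)"
    using K by (intro sum_integral_cells) (auto simp: top.not_eq_extremum[symmetric])
  also have "\<dots> = measure \<mu> D"
    using sets.sets_into_space[OF K] by (simp add: eq Int_absorb2)
  finally have w_eq: "(LINT x|\<mu>. w x) = measure \<mu> D" .
  have D_int: "integrable \<mu> (indicator D :: 'a \<Rightarrow> real)" and E_int: "integrable \<mu> (indicator E :: 'a \<Rightarrow> real)"
    using D E by (auto simp: top.not_eq_extremum[symmetric])
  have "(L2norm \<mu> (\<lambda>x. indicator D x - step_function P T (avg (indicator K)) x))\<^sup>2 =
      (LINT x|\<mu>. (indicator D x - w x)\<^sup>2)"
  proof -
    have "indicator D x - complex_of_real r = of_real (indicator D x - r)" for x r
      by (simp add: indicator_def)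
    then have "(cmod (indicator D x - of_real r))\<^sup>2 = (indicator D x - r)\<^sup>2" for x r
      by (simp only: norm_of_real power2_abs)
    then show ?thesis unfolding L2norm_power2 step by simp
  qed
  \<comment> \<open>Almost everywhere \<open>w\<close> lies between 0 and 1. On \<open>D\<close>,
    \<open>(1 - w)\<^sup>2 \<le> 1 - w\<close>. Off \<open>D\<close>,
    \<open>w\<^sup>2 \<le> w = - w + 2 * w\<close> and \<open>w\<close> is at most the indicator of
    \<open>E\<close>, since cells missing \<open>K\<close> carry weight 0. The integral of
    \<open>indicator D - w\<close> is 0, so only the mass of \<open>E\<close> remains.\<close>
  also have "\<dots> \<le> (LINT x|\<mu>. indicator D x - w x + 2 * indicator E x)"
  proof (rule integral_mono_AE')
    show "integrable \<mu> (\<lambda>x. indicator D x - w x + 2 * indicator E x)"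
      using D_int E_int w_int by auto
    have bound: "AE x in \<mu>. (indicator D x - w x)\<^sup>2 \<le> indicator D x - w x + 2 * indicator E x"
      using AE_unique_cell[OF T]
    proof eventually_elim
      case (elim x)
      then obtain p where p: "p \<in> P" "\<forall>p'\<in>P. x \<in> T p' \<longleftrightarrow> p' = p" by blast
      have w: "w x = a p" unfolding w_def by (rule sum_unique_cell[OF p])
      have xT: "x \<in> T p" using p by auto
      show ?case
      proof (cases "x \<in> D")
        case True
        have "(1 - a p)\<^sup>2 \<le> 1 - a p"
          using a01[OF p(1)] by (simp add: power2_eq_square mult_left_le)
        then show ?thesis using True w by (auto simp: indicator_def)
      next
        case False
        have "(a p)\<^sup>2 \<le> a p"
          using a01[OF p(1)] by (simp add: power2_eq_square mult_left_le)
        moreover have "a p \<le> indicator E x"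
        proof (cases "p \<inter> K = {}")
          case True then show ?thesis by (simp add: a0)
        next
          case ne: False
          then have "x \<in> E" using E(2)[OF p(1) ne] xT False by blast
          then show ?thesis using a01[OF p(1)] by simp
        qed
        ultimately show ?thesis using False w by simp
      qed
    qed
    then show "AE x in \<mu>. (indicator D x - w x)\<^sup>2 \<le> indicator D x - w x + 2 * indicator E x" .
    from bound show "AE x in \<mu>. 0 \<le> indicator D x - w x + 2 * indicator E x"
      by eventually_elim (meson order_trans zero_le_power2)
  qed
  also have "\<dots> = 2 * measure \<mu> E"
    using D_int E_int w_int w_eq sets.sets_into_space[OF D] sets.sets_into_space[OF E(1)]
    by (simp add: Int_absorb2)
  finally show ?thesis .
qed

end


section \<open>Norms on Euclidean spaces\<close>

lemma is_normD:
  assumes "is_norm nrm"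
  shows "0 \<le> nrm x" "nrm x = 0 \<longleftrightarrow> x = 0" "nrm (c *\<^sub>R x) = \<bar>c\<bar> * nrm x" "nrm (x + y) \<le> nrm x + nrm y"
  using assms unfolding is_norm_def by blast+

lemma is_norm_minus_commute: "is_norm nrm \<Longrightarrow> nrm (x - y) = nrm (y - x)"
  using Metric_space.commute[OF Metric_space_norm[of nrm], of x y] by simp

lemma is_norm_triangle: "is_norm nrm \<Longrightarrow> nrm (x - z) \<le> nrm (x - y) + nrm (y - z)"
  using Metric_space.triangle[OF Metric_space_norm[of nrm], of x y z] by simp

text \<open>Expand \<open>x\<close> in the orthonormal basis and use the triangle inequality; each
  coordinate is at most \<open>norm x\<close>.\<close>

lemma is_norm_le_norm:
  fixes nrm :: "'a::euclidean_space \<Rightarrow> real"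
  assumes "is_norm nrm"
  obtains C where "C > 0" "\<And>x. nrm x \<le> C * norm x"
proof
  \<comment> \<open>The summand 1 secures positivity, the sum being bounded below merely by
    0.\<close>
  let ?C = "1 + (\<Sum>b\<in>Basis. nrm b)"
  show pos: "?C > 0"
    using is_normD(1)[OF assms] by (intro add_pos_nonneg sum_nonneg) auto
  show "nrm x \<le> ?C * norm x" for x
  proof -
    have sum: "nrm (\<Sum>b\<in>B. f b) \<le> (\<Sum>b\<in>B. nrm (f b))" if "finite B" for f :: "'a \<Rightarrow> 'a" and B
      using that
    proof (induction B)
      case empty
      then show ?case using is_normD(2)[OF assms, of 0] by simp
    next
      case (insert b B)
      then show ?case using is_normD(4)[OF assms, of "f b" "sum f B"] by simp
    qed
    have "nrm x = nrm (\<Sum>b\<in>Basis. (x \<bullet> b) *\<^sub>R b)" by (simp add: euclidean_representation)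
    also have "\<dots> \<le> (\<Sum>b\<in>Basis. \<bar>x \<bullet> b\<bar> * nrm b)"
      using sum[OF finite_Basis, of "\<lambda>b. (x \<bullet> b) *\<^sub>R b"] is_normD(3)[OF assms] by simp
    also have "\<dots> \<le> (\<Sum>b\<in>Basis. norm x * nrm b)"
      using is_normD(1)[OF assms] by (intro sum_mono mult_right_mono Basis_le_norm)
    also have "\<dots> \<le> ?C * norm x"
      by (simp add: sum_distrib_left[symmetric] algebra_simps)
    finally show ?thesis .
  qed
qed

text \<open>\<open>nrm\<close> is Lipschitz for the Euclidean norm, so it attains a positive minimum
  on the compact unit sphere; homogeneity extends the bound to all vectors.\<close>

lemma norm_le_is_norm:
  fixes nrm :: "'a::euclidean_space \<Rightarrow> real"
  assumes n: "is_norm nrm"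
  obtains C where "C > 0" "\<And>x. norm x \<le> C * nrm x"
proof -
  obtain c where c: "c > 0" "\<And>x. nrm x \<le> c * norm x" using is_norm_le_norm[OF n] by blast
  have "\<bar>nrm x - nrm y\<bar> \<le> c * norm (x - y)" for x y
    using is_norm_triangle[OF n, of x 0 y] is_norm_triangle[OF n, of y 0 x] c(2)[of "x - y"]
      is_norm_minus_commute[OF n, of x y] by simp
  then have "c-lipschitz_on UNIV nrm"
    using c by (intro lipschitz_onI) (auto simp: dist_norm)
  then have cont: "continuous_on (sphere 0 1) nrm"
    using lipschitz_on_continuous_on continuous_on_subset by blast
  obtain b :: 'a where "b \<in> Basis" using nonempty_Basis by blast
  then have "sphere (0::'a) 1 \<noteq> {}" by (auto intro!: exI[of _ b])
  then obtain z where z: "z \<in> sphere 0 1" "\<And>x. x \<in> sphere 0 1 \<Longrightarrow> nrm z \<le> nrm x"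
    using continuous_attains_inf[OF compact_sphere _ cont] by blast
  have z_pos: "nrm z > 0"
    using z(1) is_normD(1,2)[OF n, of z] by (cases "z = 0") auto
  show ?thesis
  proof
    show "1 / nrm z > 0" using z_pos by simp
    show "norm x \<le> 1 / nrm z * nrm x" for x
    proof (cases "x = 0")
      case False
      have "nrm z \<le> nrm ((1 / norm x) *\<^sub>R x)" using False by (intro z(2)) simp
      also have "\<dots> = nrm x / norm x" using is_normD(3)[OF n] by simp
      finally show ?thesis using False z_pos by (simp add: field_simps)
    qed (use z_pos is_normD(1)[OF n, of 0] in simp)
  qed
qed


section \<open>Koopman operators of the flow\<close>

context measure_preserving_flow
begin

lemma space_mu: "space \<mu> = X"
  using sets_eq_imp_space_eq[OF sets_mu] by (simp add: space_restrict_space)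

lemma X_borel: "X \<in> sets borel"
  using compact_X by (simp add: compact_imp_closed)

lemma in_sets_mu_iff: "B \<in> sets \<mu> \<longleftrightarrow> B \<in> sets borel \<and> B \<subseteq> X"
  using sets_restrict_space_iff[of X borel] X_borel sets_mu by auto

lemma measure_X_pos: "measure \<mu> X > 0"
  using mu_nonzero by (simp add: emeasure_eq_measure zero_less_measure_iff)

lemma X_nonempty: "X \<noteq> {}"
  using mu_nonzero by auto

lemma flow_lipschitzE:
  obtains L where "L > 0"
    "\<And>s s' x y. \<lbrakk>\<bar>s\<bar> \<le> T; \<bar>s'\<bar> \<le> T; x \<in> X; y \<in> X\<rbrakk> \<Longrightarrow>
      nrm (S s x - S s' y) \<le> L * (\<bar>s - s'\<bar> + nrm (x - y))"
proof -
  \<comment> \<open>\<open>flow_lipschitz\<close> asks for a positive horizon, while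
    \<open>T\<close> is an arbitrary real here.\<close>
  let ?T = "\<bar>T\<bar> + 1"
  let ?d = "prod_dist dist (\<lambda>x y. nrm (x - y))"
  have "\<exists>L>0. \<forall>z\<in>{-?T..?T} \<times> X. \<forall>z'\<in>{-?T..?T} \<times> X.
      nrm (S (fst z) (snd z) - S (fst z') (snd z')) \<le> L * ?d z z'"
    using flow_lipschitz[of ?T]
    by (simp add: Lipschitz_continuous_map_pos norm_metric_simps[OF norm] case_prod_unfold)
  then obtain L where L: "L > 0"
    "\<And>z z'. \<lbrakk>z \<in> {-?T..?T} \<times> X; z' \<in> {-?T..?T} \<times> X\<rbrakk> \<Longrightarrow>
      nrm (S (fst z) (snd z) - S (fst z') (snd z')) \<le> L * ?d z z'"
    by blast
  show ?thesis
  proof (rule that[OF L(1)])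
    fix s s' x y assume *: "\<bar>s\<bar> \<le> T" "\<bar>s'\<bar> \<le> T" "x \<in> X" "y \<in> X"
    have "nrm (S s x - S s' y) \<le> L * ?d (s, x) (s', y)"
    proof -
      have "s \<in> {-?T..?T}" "s' \<in> {-?T..?T}" using *(1,2) by auto
      then show ?thesis using L(2)[of "(s, x)" "(s', y)"] *(3,4) by simp
    qed
    \<comment> \<open>The product metric is the square root of the sum of squares of the two
      distances, hence at most their sum.\<close>
    also have "\<dots> \<le> L * (\<bar>s - s'\<bar> + nrm (x - y))"
      using L(1) sqrt_sum_squares_le_sum[of "\<bar>s - s'\<bar>" "nrm (x - y)"] is_normD(1)[OF norm, of "x - y"]
      by (intro mult_left_mono) (auto simp: prod_dist_def dist_real_def)
    finally show "nrm (S s x - S s' y) \<le> L * (\<bar>s - s'\<bar> + nrm (x - y))" .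
  qed
qed

text \<open>The Lipschitz bound for \<open>nrm\<close> passes to the Euclidean norm by comparing the
  two norms in both directions.\<close>

lemma continuous_flow: "continuous_on X (S s)"
proof -
  obtain L where L: "L > 0" "\<And>x y. \<lbrakk>x \<in> X; y \<in> X\<rbrakk> \<Longrightarrow> nrm (S s x - S s y) \<le> L * nrm (x - y)"
  proof (rule flow_lipschitzE[of "\<bar>s\<bar>"])
    fix L assume "L > 0" and L: "\<And>s' s'' x y. \<lbrakk>\<bar>s'\<bar> \<le> \<bar>s\<bar>; \<bar>s''\<bar> \<le> \<bar>s\<bar>; x \<in> X; y \<in> X\<rbrakk> \<Longrightarrow>
      nrm (S s' x - S s'' y) \<le> L * (\<bar>s' - s''\<bar> + nrm (x - y))"
    then show thesis using L[of s s] by (intro that[of L]) simp_all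
  qed
  obtain c where c: "c > 0" "\<And>x. nrm x \<le> c * norm x" using is_norm_le_norm[OF norm] by blast
  obtain C where C: "C > 0" "\<And>x. norm x \<le> C * nrm x" using norm_le_is_norm[OF norm] by blast
  have "dist (S s x) (S s y) \<le> (C * L * c) * dist x y" if "x \<in> X" "y \<in> X" for x y
  proof -
    have "norm (S s x - S s y) \<le> C * (L * (c * norm (x - y)))"
      using L(2)[OF that] c(2)[of "x - y"] C(1) L(1)
      by (intro order_trans[OF C(2)] mult_left_mono order_trans[OF L(2)[OF that]]) auto
    then show ?thesis by (simp add: dist_norm mult_ac)
  qed
  then have "(C * L * c)-lipschitz_on X (S s)"
    using C L c by (intro lipschitz_onI) auto
  then show ?thesis by (rule lipschitz_on_continuous_on)
qed

lemma flow_inverse: "x \<in> X \<Longrightarrow> S (-s) (S s x) = x" "x \<in> X \<Longrightarrow> S s (S (-s) x) = x"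
  by (simp_all add: flow_add flow_zero)

text \<open>Invariance is assumed for images, whereas measurability and \<open>distr\<close> speak
  of preimages; invertibility of the flow exchanges the two.\<close>

lemma flow_vimage: "B \<subseteq> X \<Longrightarrow> S s -` B \<inter> X = S (-s) ` B"
proof (intro equalityI subsetI)
  fix x assume "x \<in> S s -` B \<inter> X"
  then show "x \<in> S (-s) ` B" using flow_inverse(1)[of x s] by (metis IntD1 IntD2 image_eqI vimageE)
next
  fix x assume "B \<subseteq> X" "x \<in> S (-s) ` B"
  then obtain b where "b \<in> B" "b \<in> X" "x = S (-s) b" by blast
  then show "x \<in> S s -` B \<inter> X" using flow_inverse(2)[of b s] flow_into[of b "-s"] by simp
qed

lemma flow_measurable [measurable]: "S s \<in> \<mu> \<rightarrow>\<^sub>M \<mu>"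
proof -
  have "S s \<in> restrict_space borel X \<rightarrow>\<^sub>M restrict_space borel X"
    using continuous_flow flow_into
    by (intro measurable_restrict_space2 borel_measurable_continuous_on_restrict)
      (auto simp: space_restrict_space)
  then show ?thesis by (simp add: measurable_cong_sets[OF sets_mu sets_mu])
qed

lemma flow_image_sets: "B \<in> sets \<mu> \<Longrightarrow> S s ` B \<in> sets \<mu>"
  using measurable_sets[OF flow_measurable[of "-s"], of B] flow_vimage[of B "-s"]
  by (simp add: space_mu in_sets_mu_iff)

lemma measure_flow_image: "B \<in> sets \<mu> \<Longrightarrow> measure \<mu> (S s ` B) = measure \<mu> B"
  by (simp add: measure_def mu_invariant)

lemma distr_flow: "distr \<mu> \<mu> (S s) = \<mu>"
proof (rule measure_eqI)
  fix B assume "B \<in> sets (distr \<mu> \<mu> (S s))"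
  then show "emeasure (distr \<mu> \<mu> (S s)) B = emeasure \<mu> B"
    using flow_vimage[of B s] by (simp add: emeasure_distr space_mu mu_invariant in_sets_mu_iff)
qed simp

text \<open>A change of variables, \<open>\<mu>\<close> being its own image measure by
  \<open>distr_flow\<close>.\<close>

lemma koopman_square_integrable:
  assumes "square_integrable \<mu> g"
  shows "square_integrable \<mu> (koopman S s g)"
    and "L2norm \<mu> (koopman S s g) = L2norm \<mu> g"
proof -
  have [measurable]: "g \<in> borel_measurable \<mu>" and int: "integrable \<mu> (\<lambda>x. (cmod (g x))\<^sup>2)"
    using assms by (auto simp: square_integrable_def)
  have "integrable (distr \<mu> \<mu> (S s)) (\<lambda>x. (cmod (g x))\<^sup>2)"
    using int by (simp add: distr_flow)
  then have "integrable \<mu> (\<lambda>x. (cmod (g (S s x)))\<^sup>2)"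
    by (rule integrable_distr[rotated]) measurable
  then show "square_integrable \<mu> (koopman S s g)"
    by (simp add: square_integrable_def koopman_def o_def)
  have "(LINT x|\<mu>. (cmod (g (S s x)))\<^sup>2) = (LINT x|distr \<mu> \<mu> (S s). (cmod (g x))\<^sup>2)"
    by (rule integral_distr[symmetric]) measurable
  then show "L2norm \<mu> (koopman S s g) = L2norm \<mu> g"
    by (simp add: distr_flow L2norm_def koopman_def)
qed

section \<open>Approximation by compact sets, and shrinking shells around them\<close>

lemma inner_regular_mu:
  assumes B: "B \<in> sets \<mu>" and e: "e > 0"
  obtains K where "compact K" "K \<subseteq> B" "measure \<mu> (B - K) < e"
proof -
  \<comment> \<open>\<open>inner_regular\<close> concerns measures on the Borel sets of the whole
    space, so \<open>\<mu>\<close> is pushed forward along the inclusion of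
    \<open>X\<close>.\<close>
  define M where "M = distr \<mu> borel (\<lambda>x. x)"
  have id: "(\<lambda>x. x) \<in> \<mu> \<rightarrow>\<^sub>M borel"
    unfolding measurable_cong_sets[OF sets_mu refl] by (rule measurable_restrict_space1) simp
  have M: "emeasure M A = emeasure \<mu> A" if "A \<in> sets borel" "A \<subseteq> X" for A
    using that id by (simp add: M_def emeasure_distr space_mu Int_absorb2)
  have "emeasure M (space M) \<noteq> \<infinity>"
    using id by (simp add: M_def emeasure_distr emeasure_eq_measure)
  moreover have "sets M = sets borel" by (simp add: M_def)
  moreover have B': "B \<in> sets borel" "B \<subseteq> X" using B by (auto simp: in_sets_mu_iff)
  ultimately have sup: "emeasure M B = (SUP K \<in> {K. K \<subseteq> B \<and> compact K}. emeasure M K)"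
    by (intro inner_regular)
  have "\<exists>K\<in>{K. K \<subseteq> B \<and> compact K}. measure \<mu> B < measure \<mu> K + e"
  proof (rule ccontr)
    assume neg: "\<not> ?thesis"
    have "emeasure M K \<le> ennreal (max 0 (measure \<mu> B - e))" if "K \<in> {K. K \<subseteq> B \<and> compact K}" for K
    proof -
      have "K \<in> sets borel" "K \<subseteq> X" using that B' by (auto simp: compact_imp_closed)
      moreover have "measure \<mu> K \<le> max 0 (measure \<mu> B - e)" using neg that by force
      ultimately show ?thesis by (simp add: M emeasure_eq_measure ennreal_leI)
    qed
    then have "emeasure M B \<le> ennreal (max 0 (measure \<mu> B - e))"
      unfolding sup by (rule SUP_least)
    then have "measure \<mu> B \<le> max 0 (measure \<mu> B - e)"
      using M[OF B'] by (simp add: emeasure_eq_measure)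
    \<comment> \<open>A positive mass would have to be at most itself minus \<open>e\<close>, or at
      most 0. So the mass is 0, and then the empty set is an approximating compact set, against
      \<open>neg\<close>.\<close>
    then have "measure \<mu> B = 0" using e measure_nonneg[of \<mu> B] by linarith
    then show False using neg e by (auto dest!: bspec[of _ _ "{}"])
  qed
  then obtain K where K: "K \<subseteq> B" "compact K" "measure \<mu> B < measure \<mu> K + e" by blast
  moreover have "K \<in> sets \<mu>" using K B' by (auto simp: in_sets_mu_iff compact_imp_closed)
  ultimately have "measure \<mu> (B - K) < e" using B by (simp add: finite_measure_Diff)
  with K that show ?thesis by blast
qed

text \<open>As \<open>K\<close> is closed, the shells decrease to the empty set, and a finite
  measure is continuous from above.\<close>

lemma measure_neighbourhood_tendsto:
  assumes K: "compact K" "K \<subseteq> X" "K \<noteq> {}"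
  shows "(\<lambda>n. measure \<mu> ({x \<in> X. infdist x K \<le> 1 / real (Suc n)} - K)) \<longlonglongrightarrow> 0"
proof -
  let ?N = "\<lambda>n. {x \<in> X. infdist x K \<le> 1 / real (Suc n)} - K"
  have "closed {x \<in> X. infdist x K \<le> e}" for e
    using compact_X by (auto simp: compact_imp_closed intro!: closed_Collect_conj closed_Collect_le continuous_intros)
  then have "?N n \<in> sets \<mu>" for n
    using K by (auto simp: in_sets_mu_iff compact_imp_closed)
  moreover have "decseq ?N"
  proof (rule decseq_SucI)
    fix n
    have "1 / real (Suc (Suc n)) \<le> 1 / real (Suc n)" by (intro divide_left_mono) auto
    then show "?N (Suc n) \<subseteq> ?N n" by force
  qed
  ultimately have "(\<lambda>n. measure \<mu> (?N n)) \<longlonglongrightarrow> measure \<mu> (\<Inter>n. ?N n)"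
    by (intro finite_Lim_measure_decseq) auto
  moreover have "(\<Inter>n. ?N n) = {}"
  proof -
    have "x \<in> K" if x: "\<And>n. infdist x K \<le> 1 / real (Suc n)" for x
    proof (rule ccontr)
      assume "x \<notin> K"
      then have "infdist x K > 0"
        using K infdist_pos_not_in_closed[of K x] compact_imp_closed by blast
      then obtain n where "1 / real (Suc n) < infdist x K" by (meson nat_approx_posE)
      with x[of n] show False by simp
    qed
    then show ?thesis by blast
  qed
  ultimately show ?thesis by (simp only: measure_empty)
qed

end


section \<open>Hausdorff distances along the flow\<close>

text \<open>Serves for either half of the Hausdorff distance. Nonemptiness and the bounds 0 and
  \<open>M\<close> make the real suprema and infima genuine.\<close>

lemma SUP_INF_le:
  fixes D D' :: "'a \<Rightarrow> 'b \<Rightarrow> real"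
  assumes ne: "A \<noteq> {}" "C \<noteq> {}"
    and le: "\<And>a c. a \<in> A \<Longrightarrow> c \<in> C \<Longrightarrow> D a c \<le> D' a c + e"
    and nonneg: "\<And>a c. a \<in> A \<Longrightarrow> c \<in> C \<Longrightarrow> 0 \<le> D a c" "\<And>a c. a \<in> A \<Longrightarrow> c \<in> C \<Longrightarrow> 0 \<le> D' a c"
    and bdd: "\<And>a c. a \<in> A \<Longrightarrow> c \<in> C \<Longrightarrow> D' a c \<le> M"
  shows "(SUP a\<in>A. INF c\<in>C. D a c) \<le> (SUP a\<in>A. INF c\<in>C. D' a c) + e"
proof (rule cSUP_least[OF ne(1)])
  fix a assume a: "a \<in> A"
  obtain c0 where c0: "c0 \<in> C" using ne by blast
  have bddD: "bdd_below (D b ` C)" and bddD': "bdd_below (D' b ` C)" if "b \<in> A" for b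
    using nonneg that by (auto intro!: bdd_belowI2[where m = 0])
  have "(INF c\<in>C. D a c) - e \<le> (INF c\<in>C. D' a c)"
    using le[OF a] cINF_lower[OF bddD[OF a]] by (intro cINF_greatest[OF ne(2)]) force
  also have "\<dots> \<le> (SUP a\<in>A. INF c\<in>C. D' a c)"
    using bdd c0 bddD' by (intro cSUP_upper[OF a] bdd_aboveI2[where M = M]) (meson cINF_lower2)
  finally show "(INF c\<in>C. D a c) \<le> (SUP a\<in>A. INF c\<in>C. D' a c) + e" by simp
qed

lemma hausdorff_distance_image:
  assumes "is_norm nrm"
  shows "hausdorff_distance (norm_metric nrm) (f ` A) C =
    max (SUP a\<in>A. INF c\<in>C. nrm (f a - c)) (SUP c\<in>C. INF a\<in>A. nrm (f a - c))"
  by (simp add: hausdorff_distance_def norm_metric_simps[OF assms] image_image)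

lemma hausdorff_distance_image_le:
  assumes n: "is_norm nrm" and ne: "A \<noteq> {}" "C \<noteq> {}"
    and le: "\<And>a. a \<in> A \<Longrightarrow> nrm (f a - f' a) \<le> e"
    and bdd: "\<And>a c. a \<in> A \<Longrightarrow> c \<in> C \<Longrightarrow> nrm (f' a - c) \<le> M"
  shows "hausdorff_distance (norm_metric nrm) (f ` A) C \<le>
    hausdorff_distance (norm_metric nrm) (f' ` A) C + e"
proof -
  have "nrm (f a - c) \<le> nrm (f' a - c) + e" if "a \<in> A" for a c
    using is_norm_triangle[OF n, of "f a" c "f' a"] le[OF that] by simp
  then have "(SUP a\<in>A. INF c\<in>C. nrm (f a - c)) \<le> (SUP a\<in>A. INF c\<in>C. nrm (f' a - c)) + e"
    and "(SUP c\<in>C. INF a\<in>A. nrm (f a - c)) \<le> (SUP c\<in>C. INF a\<in>A. nrm (f' a - c)) + e"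
    using bdd is_normD(1)[OF n] ne by (intro SUP_INF_le[where M = M]; blast)+
  then show ?thesis by (auto simp: hausdorff_distance_image[OF n])
qed

lemma hausdorff_distance_bounds:
  assumes n: "is_norm nrm" and ne: "B \<noteq> {}" "C \<noteq> {}"
    and bdd: "\<And>b c. b \<in> B \<Longrightarrow> c \<in> C \<Longrightarrow> nrm (b - c) \<le> M"
  shows "0 \<le> hausdorff_distance (norm_metric nrm) B C"
    and "hausdorff_distance (norm_metric nrm) B C \<le> M"
proof -
  note eq = hausdorff_distance_image[OF n, of "\<lambda>x. x", simplified]
  have "0 \<le> M" using ne bdd is_normD(1)[OF n] by (meson ex_in_conv order_trans)
  have SUP_const: "(SUP a\<in>B. INF c\<in>C. r) = r" for r :: real using ne by simp
  have SUP_const': "(SUP c\<in>C. INF a\<in>B. r) = r" for r :: real using ne by simp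
  \<comment> \<open>Both estimates compare with a constant function: 0 from below, \<open>M\<close>
    from above.\<close>
  have "(SUP b\<in>B. INF c\<in>C. 0) \<le> (SUP b\<in>B. INF c\<in>C. nrm (b - c)) + 0"
    using bdd is_normD(1)[OF n] by (intro SUP_INF_le[OF ne, where M = M]) auto
  then show "0 \<le> hausdorff_distance (norm_metric nrm) B C"
    unfolding eq SUP_const by simp
  have "(SUP b\<in>B. INF c\<in>C. nrm (b - c)) \<le> (SUP b\<in>B. INF c\<in>C. M) + 0"
    and "(SUP c\<in>C. INF b\<in>B. nrm (b - c)) \<le> (SUP c\<in>C. INF b\<in>B. M) + 0"
    using bdd is_normD(1)[OF n] \<open>0 \<le> M\<close> ne by (intro SUP_INF_le[where M = M]; auto)+
  then show "hausdorff_distance (norm_metric nrm) B C \<le> M"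
    unfolding eq SUP_const SUP_const' by simp
qed

text \<open>The half of the distance that runs over \<open>C\<close> bounds the infimum at
  \<open>c\<close>, and an infimum strictly below \<open>e\<close> is undercut by some point
  \<open>b\<close>.\<close>

lemma hausdorff_distance_lessE:
  assumes n: "is_norm nrm" and ne: "B \<noteq> {}" "C \<noteq> {}"
    and bdd: "\<And>b c. b \<in> B \<Longrightarrow> c \<in> C \<Longrightarrow> nrm (b - c) \<le> M"
    and less: "hausdorff_distance (norm_metric nrm) B C < e" and c: "c \<in> C"
  obtains b where "b \<in> B" "nrm (b - c) < e"
proof -
  have bdd_below: "bdd_below ((\<lambda>b. nrm (b - c)) ` B)" for c
    using is_normD(1)[OF n] by (auto intro!: bdd_belowI2[where m = 0])
  obtain b0 where "b0 \<in> B" using ne by blast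
  then have "bdd_above ((\<lambda>c. INF b\<in>B. nrm (b - c)) ` C)"
    using bdd bdd_below by (intro bdd_aboveI2[where M = M]) (meson cINF_lower2)
  then have "(INF b\<in>B. nrm (b - c)) \<le> (SUP c\<in>C. INF b\<in>B. nrm (b - c))"
    using c by (rule cSUP_upper[rotated])
  also have "\<dots> < e"
    using less by (simp add: hausdorff_distance_def norm_metric_simps[OF n])
  finally show ?thesis
    using cINF_less_iff[OF ne(1) bdd_below] that by blast
qed

context measure_preserving_flow
begin

lemma bounded_diameter: "\<exists>M. \<forall>x\<in>X. \<forall>y\<in>X. nrm (x - y) \<le> M"
proof -
  obtain B where B: "\<And>x. x \<in> X \<Longrightarrow> norm x \<le> B"
    using compact_imp_bounded[OF compact_X] by (auto simp: bounded_iff)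
  obtain c where c: "c > 0" "\<And>x. nrm x \<le> c * norm x" using is_norm_le_norm[OF norm] by blast
  have "nrm (x - y) \<le> c * (B + B)" if "x \<in> X" "y \<in> X" for x y
    using c B that
    by (intro order_trans[OF c(2)] mult_left_mono order_trans[OF norm_triangle_ineq4] add_mono) auto
  then show ?thesis by blast
qed

text \<open>On bounded time intervals the points of \<open>A\<close> move at speed at most
  \<open>L\<close>, so the distance is locally Lipschitz in time. This yields the measurability of
  \<open>set_error\<close>.\<close>

lemma continuous_hausdorff_distance_flow:
  assumes A: "A \<subseteq> X" "A \<noteq> {}" and C: "C \<subseteq> X" "C \<noteq> {}"
  shows "continuous_on UNIV (\<lambda>s. hausdorff_distance (norm_metric nrm) (S s ` A) C)"
proof -
  obtain M where M: "\<And>x y. \<lbrakk>x \<in> X; y \<in> X\<rbrakk> \<Longrightarrow> nrm (x - y) \<le> M" using bounded_diameter by blast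
  let ?h = "\<lambda>s. hausdorff_distance (norm_metric nrm) (S s ` A) C"
  have "isCont ?h s0" for s0
  proof -
    let ?T = "\<bar>s0\<bar> + 1"
    obtain L where L: "L > 0" "\<And>s s' x y. \<lbrakk>\<bar>s\<bar> \<le> ?T; \<bar>s'\<bar> \<le> ?T; x \<in> X; y \<in> X\<rbrakk> \<Longrightarrow>
        nrm (S s x - S s' y) \<le> L * (\<bar>s - s'\<bar> + nrm (x - y))"
      using flow_lipschitzE[of ?T] by blast
    have le: "?h s \<le> ?h s' + L * \<bar>s - s'\<bar>" if "\<bar>s\<bar> \<le> ?T" "\<bar>s'\<bar> \<le> ?T" for s s'
    proof (rule hausdorff_distance_image_le[OF norm A(2) C(2)])
      show "nrm (S s a - S s' a) \<le> L * \<bar>s - s'\<bar>" if "a \<in> A" for a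
        using L(2)[of s s' a a] \<open>\<bar>s\<bar> \<le> ?T\<close> \<open>\<bar>s'\<bar> \<le> ?T\<close> that A is_normD(2)[OF norm, of 0] by auto
      show "nrm (S s' a - c) \<le> M" if "a \<in> A" "c \<in> C" for a c
        using that A C by (intro M flow_into) auto
    qed
    have "L-lipschitz_on {s0 - 1<..<s0 + 1} ?h"
    proof (rule lipschitz_onI)
      fix s s' assume "s \<in> {s0 - 1<..<s0 + 1}" "s' \<in> {s0 - 1<..<s0 + 1}"
      then have "\<bar>s\<bar> \<le> ?T" "\<bar>s'\<bar> \<le> ?T" by auto
      from le[OF this] le[OF this(2,1)] show "dist (?h s) (?h s') \<le> L * dist s s'"
        by (simp add: dist_real_def abs_minus_commute[of s' s])
    qed (use L in simp)
    then have "continuous_on {s0 - 1<..<s0 + 1} ?h" by (rule lipschitz_on_continuous_on)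
    then show ?thesis by (simp add: continuous_on_eq_continuous_at)
  qed
  then show ?thesis by (simp add: continuous_on_eq_continuous_at)
qed

end

section \<open>Iterates of the cell maps and rounded times\<close>

lemma bij_betw_cell_iterate:
  assumes "bij_betw F P P"
  shows "bij_betw (cell_iterate P F k) P P"
proof (cases "k \<ge> 0")
  case True
  then show ?thesis
    using bij_betw_funpow[OF assms] by (simp add: cell_iterate_def[abs_def])
next
  case False
  then show ?thesis
    using bij_betw_funpow[OF bij_betw_inv_into[OF assms]] by (simp add: cell_iterate_def[abs_def])
qed

text \<open>Rounding is odd in \<open>s\<close>. Hence the inverse iterate inside
  \<open>discrete_koopman\<close> moves the cells as the discrete dynamics does at time
  \<open>-s\<close>.\<close>

lemma xi_steps_minus: "\<delta> > 0 \<Longrightarrow> xi_steps \<delta> (-s) = - xi_steps \<delta> s"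
  using floor_of_int[of "-1", where 'a = real] by (simp add: xi_steps_eq(1) sgn_if)

lemma xi_steps_measurable:
  assumes "\<delta> > 0"
  shows "xi_steps \<delta> \<in> borel \<rightarrow>\<^sub>M count_space UNIV"
proof -
  have "xi_steps \<delta> = (\<lambda>s. \<lfloor>sgn s\<rfloor> * \<lceil>\<bar>s\<bar> / \<delta>\<rceil>)"
    by (rule ext) (rule xi_steps_eq(1)[OF assms])
  then show ?thesis by simp
qed


section \<open>Convergence of the discrete Koopman operators\<close>

locale discretised_flow =
  measure_preserving_flow \<mu> nrm X S + partition_sequence "norm_metric nrm" \<mu> P q l
  for \<mu> :: "(real ^ 'n) measure" and nrm X S P q l +
  fixes \<tau> :: "nat \<Rightarrow> real" and F :: "nat \<Rightarrow> (real ^ 'n) set \<Rightarrow> (real ^ 'n) set"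
  assumes time_steps: "time_steps \<tau>"
    and bij_F: "n \<ge> 1 \<Longrightarrow> bij_betw (F n) (P n) (P n)"
begin

lemma tau_pos: "n \<ge> 1 \<Longrightarrow> \<tau> n > 0"
  using time_steps by (simp add: time_steps_def)

lemma equal_partition: "n \<ge> 1 \<Longrightarrow> equal_partition \<mu> (P n) (q n)"
proof
  assume n: "n \<ge> 1"
  show "measure \<mu> (space \<mu>) > 0" using measure_X_pos by (simp add: space_mu)
  have "P n \<noteq> {}" using cells_cover[OF n] X_nonempty by (auto simp: space_mu)
  then show "q n > 0" using finite_cells[OF n] card_cells[OF n] by (metis card_gt_0_iff)
qed (simp_all add: finite_cells cells_measurable cells_cover cells_overlap cells_measure)

abbreviation moved_cell :: "nat \<Rightarrow> real \<Rightarrow> (real ^ 'n) set \<Rightarrow> (real ^ 'n) set" where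
  "moved_cell n s \<equiv> cell_iterate (P n) (F n) (xi_steps (\<tau> n) s)"

lemma bij_moved_cell: "n \<ge> 1 \<Longrightarrow> bij_betw (moved_cell n s) (P n) (P n)"
  using bij_betw_cell_iterate[OF bij_F] .

text \<open>The integrand in \<open>periodically_approximates\<close>; \<open>koopman_error\<close>
  below is the integrand of the theorem.\<close>

definition set_error :: "nat \<Rightarrow> (real ^ 'n) set \<Rightarrow> real \<Rightarrow> real" where
  "set_error n A s = hausdorff_distance (norm_metric nrm) (S s ` A)
     (union_iterate (P n) (F n) (xi_steps (\<tau> n) s) (outer_cells (P n) A))"

definition koopman_error :: "nat \<Rightarrow> (real ^ 'n \<Rightarrow> complex) \<Rightarrow> real \<Rightarrow> real" where
  "koopman_error n g s = (L2norm \<mu> (\<lambda>x. koopman S s g x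
     - discrete_koopman \<mu> (P n) (F n) (q n) (xi_steps (\<tau> n) s) (averaging \<mu> (P n) (q n) g) x))\<^sup>2"

lemma cell_subset_X: "n \<ge> 1 \<Longrightarrow> p \<in> P n \<Longrightarrow> p \<subseteq> X"
  using cells_cover by (auto simp: space_mu)

lemma cell_nonempty: "n \<ge> 1 \<Longrightarrow> p \<in> P n \<Longrightarrow> p \<noteq> {}"
  using equal_partition.measure_P_pos[OF equal_partition] by fastforce

lemma moved_cell_subset:
  assumes "p \<in> P n" "p \<inter> A \<noteq> {}"
  shows "moved_cell n s p \<subseteq> union_iterate (P n) (F n) (xi_steps (\<tau> n) s) (outer_cells (P n) A)"
  using assms by (auto simp: union_iterate_def outer_cells_def)

lemma union_iterate_subset_X:
  assumes "n \<ge> 1" shows "union_iterate (P n) (F n) k B \<subseteq> X"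
  using cell_subset_X[OF assms] bij_betw_cell_iterate[OF bij_F[OF assms], of k]
  by (auto simp: union_iterate_def bij_betw_def)

text \<open>Some cell meets \<open>A\<close> by covering, and its iterate is again a cell, of
  positive measure. The Hausdorff distance in \<open>set_error\<close> is thus between nonempty
  sets.\<close>

lemma union_iterate_nonempty:
  assumes n: "n \<ge> 1" and A: "A \<subseteq> X" "A \<noteq> {}"
  shows "union_iterate (P n) (F n) k (outer_cells (P n) A) \<noteq> {}"
proof -
  obtain a where a: "a \<in> A" "a \<in> X" using A by blast
  then obtain p where p: "p \<in> P n" "a \<in> p" using cells_cover[OF n] by (auto simp: space_mu)
  have "cell_iterate (P n) (F n) k p \<in> P n"
    using bij_betw_cell_iterate[OF bij_F[OF n], of k] p by (auto simp: bij_betw_def)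
  then have "cell_iterate (P n) (F n) k p \<noteq> {}" by (rule cell_nonempty[OF n])
  moreover have "cell_iterate (P n) (F n) k p \<subseteq> union_iterate (P n) (F n) k (outer_cells (P n) A)"
    using p a by (auto simp: union_iterate_def outer_cells_def)
  ultimately show ?thesis by blast
qed

lemma nrm_diff_union_iterate_le:
  assumes n: "n \<ge> 1" and A: "A \<subseteq> X" and M: "\<And>x y. \<lbrakk>x \<in> X; y \<in> X\<rbrakk> \<Longrightarrow> nrm (x - y) \<le> M"
    and b: "b \<in> S s ` A" and c: "c \<in> union_iterate (P n) (F n) k B"
  shows "nrm (b - c) \<le> M"
proof (rule M)
  show "b \<in> X" using b A flow_into by auto
  show "c \<in> X" using c union_iterate_subset_X[OF n] by blast
qed

lemma set_error_bounds:
  assumes n: "n \<ge> 1" and A: "A \<subseteq> X" "A \<noteq> {}" and M: "\<And>x y. \<lbrakk>x \<in> X; y \<in> X\<rbrakk> \<Longrightarrow> nrm (x - y) \<le> M"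
  shows "0 \<le> set_error n A s" "set_error n A s \<le> M"
proof -
  have le: "nrm (b - c) \<le> M"
    if "b \<in> S s ` A" "c \<in> union_iterate (P n) (F n) (xi_steps (\<tau> n) s) (outer_cells (P n) A)" for b c
    by (rule nrm_diff_union_iterate_le[OF n A(1) M that])
  have "S s ` A \<noteq> {}" using A by auto
  note * = hausdorff_distance_bounds[OF norm this union_iterate_nonempty[OF n A] le]
  show "0 \<le> set_error n A s" unfolding set_error_def by (rule *(1))
  show "set_error n A s \<le> M" unfolding set_error_def by (rule *(2))
qed

text \<open>The form in which a small Hausdorff error is used: points of a transported cell that met
  \<open>A\<close> are close to the true image of \<open>A\<close>.\<close>

lemma set_error_lessE:
  assumes n: "n \<ge> 1" and A: "A \<subseteq> X" "A \<noteq> {}" and less: "set_error n A s < e"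
    and p: "p \<in> P n" "p \<inter> A \<noteq> {}" and x: "x \<in> moved_cell n s p"
  obtains a where "a \<in> A" "nrm (S s a - x) < e"
proof -
  obtain M where M: "\<And>x y. \<lbrakk>x \<in> X; y \<in> X\<rbrakk> \<Longrightarrow> nrm (x - y) \<le> M" using bounded_diameter by blast
  have le: "nrm (b - c) \<le> M"
    if "b \<in> S s ` A" "c \<in> union_iterate (P n) (F n) (xi_steps (\<tau> n) s) (outer_cells (P n) A)" for b c
    by (rule nrm_diff_union_iterate_le[OF n A(1) M that])
  have ne: "S s ` A \<noteq> {}" using A by auto
  obtain b where "b \<in> S s ` A" "nrm (b - x) < e"
    by (rule hausdorff_distance_lessE[OF norm ne union_iterate_nonempty[OF n A] le
        less[unfolded set_error_def] subsetD[OF moved_cell_subset[OF p] x]])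
  with that show ?thesis by auto
qed

lemma set_error_integrable:
  assumes n: "n \<ge> 1" and A: "A \<subseteq> X" "A \<noteq> {}" and T: "0 \<le> T"
  shows "interval_lebesgue_integrable lborel (ereal (-T)) (ereal T) (set_error n A)"
proof -
  obtain M where M: "\<And>x y. \<lbrakk>x \<in> X; y \<in> X\<rbrakk> \<Longrightarrow> nrm (x - y) \<le> M" using bounded_diameter by blast
  \<comment> \<open>For a fixed number \<open>k\<close> of steps the second set is constant and the
    distance continuous in \<open>s\<close>. Since \<open>xi_steps\<close> is a measurable function
    with countable range, inserting it for \<open>k\<close> preserves measurability.\<close>
  have "(\<lambda>s. hausdorff_distance (norm_metric nrm) (S s ` A)
      (union_iterate (P n) (F n) k (outer_cells (P n) A))) \<in> borel_measurable borel" for k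
    by (intro borel_measurable_continuous_onI continuous_hausdorff_distance_flow A
        union_iterate_subset_X n union_iterate_nonempty)
  then have "(\<lambda>s. hausdorff_distance (norm_metric nrm) (S s ` A)
      (union_iterate (P n) (F n) (xi_steps (\<tau> n) s) (outer_cells (P n) A))) \<in> borel_measurable borel"
    by (rule measurable_compose_countable[OF _ xi_steps_measurable[OF tau_pos[OF n]]])
  then have [measurable]: "set_error n A \<in> borel_measurable borel"
    by (simp add: set_error_def[abs_def])
  have "set_integrable lborel {-T<..<T} (set_error n A)"
    unfolding set_integrable_def
  proof (rule Bochner_Integration.integrable_bound[of _ "\<lambda>s. M * indicator {-T<..<T} s"])
    show "integrable lborel (\<lambda>s. M * indicator {-T<..<T} s)"
      using T by (auto intro!: integrable_mult_right integrable_real_indicator)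
    show "AE s in lborel. norm (indicator {-T<..<T} s *\<^sub>R set_error n A s) \<le> norm (M * indicator {-T<..<T} s)"
      using set_error_bounds[OF n A M] by (auto simp: indicator_def intro!: AE_I2 order_trans[OF _ abs_ge_self])
  qed measurable
  then show ?thesis
    using T by (simp add: interval_lebesgue_integrable_def einterval_eq)
qed

text \<open>The averaged function has the cell averages of \<open>g\<close> as coefficients,
  recovered by \<open>discrete_koopman_span\<close>; the sign of the iterate is absorbed by
  \<open>xi_steps_minus\<close>.\<close>

lemma discrete_koopman_averaging:
  assumes "n \<ge> 1"
  shows "discrete_koopman \<mu> (P n) (F n) (q n) (xi_steps (\<tau> n) s) (averaging \<mu> (P n) (q n) g) =
    step_function (P n) (moved_cell n (-s)) (cell_average \<mu> (q n) g)"
  unfolding averaging_def step_function_def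
  using discrete_koopman_span[OF finite_measure_axioms _ assms] measure_X_pos
  by (simp add: space_mu xi_steps_minus[OF tau_pos[OF assms]])

lemma koopman_error_eq:
  "n \<ge> 1 \<Longrightarrow> koopman_error n g s = (L2norm \<mu> (\<lambda>x. koopman S s g x
     - step_function (P n) (moved_cell n (-s)) (cell_average \<mu> (q n) g) x))\<^sup>2"
  by (simp add: koopman_error_def discrete_koopman_averaging)

lemma koopman_error_nonneg: "0 \<le> koopman_error n g s"
  by (simp add: koopman_error_def)

lemma square_integrable_step:
  "n \<ge> 1 \<Longrightarrow> square_integrable \<mu> g \<Longrightarrow>
    square_integrable \<mu> (step_function (P n) (moved_cell n s) (cell_average \<mu> (q n) g))"
  by (rule equal_partition.L2norm_step_function_avg_le[OF equal_partition bij_moved_cell])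

text \<open>Both operators are contractions. The bound serves for the remainder of an approximation
  and for the times at which a set error is large.\<close>

lemma koopman_error_le:
  assumes n: "n \<ge> 1" and g: "square_integrable \<mu> g"
  shows "koopman_error n g s \<le> 4 * (L2norm \<mu> g)\<^sup>2"
  using L2norm_diff_power2_le[OF koopman_square_integrable(1)[OF g, of s] square_integrable_step[OF n g, of "-s"]]
    equal_partition.L2norm_step_function_avg_le(2)[OF equal_partition[OF n] bij_moved_cell[OF n] g, of "-s"]
  by (simp add: koopman_error_eq[OF n] koopman_square_integrable(2)[OF g])

lemma koopman_error_add:
  assumes n: "n \<ge> 1" and f: "square_integrable \<mu> f" and g: "square_integrable \<mu> g"
  shows "koopman_error n (\<lambda>x. f x + g x) s \<le> 2 * koopman_error n f s + 2 * koopman_error n g s"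
proof -
  let ?d = "\<lambda>g x. koopman S s g x - step_function (P n) (moved_cell n (-s)) (cell_average \<mu> (q n) g) x"
  have "?d (\<lambda>x. f x + g x) = (\<lambda>x. ?d f x + ?d g x)"
    by (rule ext) (simp add: equal_partition.step_function_avg_add[OF equal_partition[OF n] f g] koopman_def)
  then show ?thesis
    unfolding koopman_error_eq[OF n]
    using L2norm_add_power2_le[of \<mu> "?d f" "?d g"] f g n
    by (simp add: square_integrable_diff koopman_square_integrable square_integrable_step)
qed

lemma koopman_error_cmult:
  assumes n: "n \<ge> 1"
  shows "koopman_error n (\<lambda>x. c * g x) s = (cmod c)\<^sup>2 * koopman_error n g s"
proof -
  let ?d = "\<lambda>g x. koopman S s g x - step_function (P n) (moved_cell n (-s)) (cell_average \<mu> (q n) g) x"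
  have "?d (\<lambda>x. c * g x) = (\<lambda>x. c * ?d g x)"
    by (rule ext) (simp add: equal_partition.step_function_avg_cmult[OF equal_partition[OF n]] koopman_def
        right_diff_distrib)
  then show ?thesis
    unfolding koopman_error_eq[OF n] by (simp only: L2norm_cmult_power2)
qed

text \<open>The family \<open>\<A>\<close> and the threshold \<open>\<eta>\<close> are fixed before
  \<open>n\<close> and \<open>s\<close>. The set error is taken at time \<open>-s\<close> because
  composition with \<open>S s\<close> turns the indicator of \<open>K\<close> into that of the image
  of \<open>K\<close> at time \<open>-s\<close>.\<close>

definition controlled :: "real \<Rightarrow> (real ^ 'n \<Rightarrow> complex) \<Rightarrow> bool" where
  "controlled T g \<longleftrightarrow> square_integrable \<mu> g \<and>
     (\<forall>\<epsilon>>0. \<exists>\<A> \<eta>. finite \<A> \<and> (\<forall>A\<in>\<A>. compact A \<and> A \<subseteq> X \<and> A \<noteq> {}) \<and> \<eta> > 0 \<and>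
       (\<forall>n s. n \<ge> 1 \<longrightarrow> \<bar>s\<bar> \<le> T \<longrightarrow> (\<forall>A\<in>\<A>. set_error n A (-s) < \<eta>) \<longrightarrow> koopman_error n g s \<le> \<epsilon>))"

lemma controlledE:
  assumes "controlled T g" "\<epsilon> > 0"
  obtains \<A> \<eta> where "finite \<A>" "\<And>A. A \<in> \<A> \<Longrightarrow> compact A \<and> A \<subseteq> X \<and> A \<noteq> {}" "\<eta> > 0"
    "\<And>n s. \<lbrakk>n \<ge> 1; \<bar>s\<bar> \<le> T; \<And>A. A \<in> \<A> \<Longrightarrow> set_error n A (-s) < \<eta>\<rbrakk> \<Longrightarrow> koopman_error n g s \<le> \<epsilon>"
  using assms unfolding controlled_def by metis

lemma controlled_add:
  assumes f: "controlled T f" and g: "controlled T g"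
  shows "controlled T (\<lambda>x. f x + g x)"
  unfolding controlled_def
proof (intro conjI allI impI)
  have sq: "square_integrable \<mu> f" "square_integrable \<mu> g"
    using f g by (auto simp: controlled_def)
  then show "square_integrable \<mu> (\<lambda>x. f x + g x)" by (rule square_integrable_add)
  fix \<epsilon> :: real assume \<epsilon>: "\<epsilon> > 0"
  \<comment> \<open>\<open>koopman_error_add\<close> doubles both errors. Uniting the families and
    taking the smaller threshold meets both conditions at once.\<close>
  then have "\<epsilon> / 4 > 0" by simp
  obtain \<A> \<eta> where A: "finite \<A>" "\<And>A. A \<in> \<A> \<Longrightarrow> compact A \<and> A \<subseteq> X \<and> A \<noteq> {}" "\<eta> > 0"
    "\<And>n s. \<lbrakk>n \<ge> 1; \<bar>s\<bar> \<le> T; \<And>A. A \<in> \<A> \<Longrightarrow> set_error n A (-s) < \<eta>\<rbrakk> \<Longrightarrow> koopman_error n f s \<le> \<epsilon> / 4"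
    using controlledE[OF f \<open>\<epsilon> / 4 > 0\<close>] by blast
  obtain \<B> \<theta> where B: "finite \<B>" "\<And>A. A \<in> \<B> \<Longrightarrow> compact A \<and> A \<subseteq> X \<and> A \<noteq> {}" "\<theta> > 0"
    "\<And>n s. \<lbrakk>n \<ge> 1; \<bar>s\<bar> \<le> T; \<And>A. A \<in> \<B> \<Longrightarrow> set_error n A (-s) < \<theta>\<rbrakk> \<Longrightarrow> koopman_error n g s \<le> \<epsilon> / 4"
    using controlledE[OF g \<open>\<epsilon> / 4 > 0\<close>] by blast
  show "\<exists>\<A> \<eta>. finite \<A> \<and> (\<forall>A\<in>\<A>. compact A \<and> A \<subseteq> X \<and> A \<noteq> {}) \<and> \<eta> > 0 \<and>
      (\<forall>n s. n \<ge> 1 \<longrightarrow> \<bar>s\<bar> \<le> T \<longrightarrow> (\<forall>A\<in>\<A>. set_error n A (-s) < \<eta>) \<longrightarrow> koopman_error n (\<lambda>x. f x + g x) s \<le> \<epsilon>)"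
  proof (intro exI[of _ "\<A> \<union> \<B>"] exI[of _ "min \<eta> \<theta>"] conjI allI impI)
    fix n s assume *: "1 \<le> n" "\<bar>s\<bar> \<le> T" "\<forall>A\<in>\<A> \<union> \<B>. set_error n A (-s) < min \<eta> \<theta>"
    have "koopman_error n f s \<le> \<epsilon> / 4" using * by (intro A(4)) auto
    moreover have "koopman_error n g s \<le> \<epsilon> / 4" using * by (intro B(4)) auto
    ultimately show "koopman_error n (\<lambda>x. f x + g x) s \<le> \<epsilon>"
      using koopman_error_add[OF *(1) sq, of s] by simp
  qed (use A(1-3) B(1-3) in \<open>(blast | simp)+\<close>)
qed

lemma controlled_cmult:
  assumes g: "controlled T g"
  shows "controlled T (\<lambda>x. c * g x)"
  unfolding controlled_def
proof (intro conjI allI impI)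
  show "square_integrable \<mu> (\<lambda>x. c * g x)"
    using g by (auto simp: controlled_def intro: square_integrable_cmult)
  fix \<epsilon> :: real assume "\<epsilon> > 0"
  \<comment> \<open>The added 1 keeps the divisor positive when \<open>c = 0\<close>.\<close>
  let ?d = "(cmod c)\<^sup>2 + 1"
  have d: "?d > 0" by (simp add: add_nonneg_pos)
  with \<open>\<epsilon> > 0\<close> have "\<epsilon> / ?d > 0" by simp
  then obtain \<A> \<eta> where A: "finite \<A>" "\<And>A. A \<in> \<A> \<Longrightarrow> compact A \<and> A \<subseteq> X \<and> A \<noteq> {}" "\<eta> > 0"
    "\<And>n s. \<lbrakk>n \<ge> 1; \<bar>s\<bar> \<le> T; \<And>A. A \<in> \<A> \<Longrightarrow> set_error n A (-s) < \<eta>\<rbrakk> \<Longrightarrow> koopman_error n g s \<le> \<epsilon> / ?d"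
    using controlledE[OF g] by blast
  show "\<exists>\<A> \<eta>. finite \<A> \<and> (\<forall>A\<in>\<A>. compact A \<and> A \<subseteq> X \<and> A \<noteq> {}) \<and> \<eta> > 0 \<and>
      (\<forall>n s. n \<ge> 1 \<longrightarrow> \<bar>s\<bar> \<le> T \<longrightarrow> (\<forall>A\<in>\<A>. set_error n A (-s) < \<eta>) \<longrightarrow> koopman_error n (\<lambda>x. c * g x) s \<le> \<epsilon>)"
  proof (intro exI[of _ \<A>] exI[of _ \<eta>] conjI allI impI)
    fix n s assume *: "1 \<le> n" "\<bar>s\<bar> \<le> T" "\<forall>A\<in>\<A>. set_error n A (-s) < \<eta>"
    have "(cmod c)\<^sup>2 * koopman_error n g s \<le> ?d * (\<epsilon> / ?d)"
      using * d by (intro mult_mono A(4) koopman_error_nonneg) auto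
    then show "koopman_error n (\<lambda>x. c * g x) s \<le> \<epsilon>"
      using d by (simp add: koopman_error_cmult[OF *(1)])
  qed (use A(1-3) in \<open>(blast | simp)+\<close>)
qed

lemma controlled_limit:
  assumes g: "square_integrable \<mu> g"
    and approx: "\<And>\<epsilon>. \<epsilon> > 0 \<Longrightarrow> \<exists>h. controlled T h \<and> (L2norm \<mu> (\<lambda>x. g x - h x))\<^sup>2 < \<epsilon>"
  shows "controlled T g"
  unfolding controlled_def
proof (intro conjI allI impI g)
  fix \<epsilon> :: real assume "\<epsilon> > 0"
  \<comment> \<open>The factor 4 of \<open>koopman_error_le\<close> turns
    \<open>\<epsilon> / 16\<close> into \<open>\<epsilon> / 4\<close> for the remainder
    \<open>g - h\<close>; doubling this and the error of \<open>h\<close> gives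
    \<open>\<epsilon>\<close>.\<close>
  then have "\<epsilon> / 16 > 0" "\<epsilon> / 4 > 0" by auto
  then obtain h where h: "controlled T h" "(L2norm \<mu> (\<lambda>x. g x - h x))\<^sup>2 < \<epsilon> / 16"
    using approx by blast
  have sq: "square_integrable \<mu> h" using h by (simp add: controlled_def)
  have sqd: "square_integrable \<mu> (\<lambda>x. g x - h x)" by (rule square_integrable_diff[OF g sq])
  obtain \<A> \<eta> where A: "finite \<A>" "\<And>A. A \<in> \<A> \<Longrightarrow> compact A \<and> A \<subseteq> X \<and> A \<noteq> {}" "\<eta> > 0"
    "\<And>n s. \<lbrakk>n \<ge> 1; \<bar>s\<bar> \<le> T; \<And>A. A \<in> \<A> \<Longrightarrow> set_error n A (-s) < \<eta>\<rbrakk> \<Longrightarrow> koopman_error n h s \<le> \<epsilon> / 4"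
    using controlledE[OF h(1) \<open>\<epsilon> / 4 > 0\<close>] by blast
  show "\<exists>\<A> \<eta>. finite \<A> \<and> (\<forall>A\<in>\<A>. compact A \<and> A \<subseteq> X \<and> A \<noteq> {}) \<and> \<eta> > 0 \<and>
      (\<forall>n s. n \<ge> 1 \<longrightarrow> \<bar>s\<bar> \<le> T \<longrightarrow> (\<forall>A\<in>\<A>. set_error n A (-s) < \<eta>) \<longrightarrow> koopman_error n g s \<le> \<epsilon>)"
  proof (intro exI[of _ \<A>] exI[of _ \<eta>] conjI allI impI)
    fix n s assume *: "1 \<le> n" "\<bar>s\<bar> \<le> T" "\<forall>A\<in>\<A>. set_error n A (-s) < \<eta>"
    have "koopman_error n h s \<le> \<epsilon> / 4" using * by (intro A(4)) auto
    moreover have "koopman_error n (\<lambda>x. g x - h x) s \<le> \<epsilon> / 4"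
      using koopman_error_le[OF *(1) sqd, of s] h(2) by simp
    moreover have "koopman_error n g s \<le> 2 * koopman_error n h s + 2 * koopman_error n (\<lambda>x. g x - h x) s"
      using koopman_error_add[OF *(1) sq sqd, of s] by simp
    ultimately show "koopman_error n g s \<le> \<epsilon>" by simp
  qed (use A(1-3) in \<open>(blast | simp)+\<close>)
qed

text \<open>A point of a transported cell outside \<open>D\<close> flows in time \<open>s\<close> to
  a point near \<open>K\<close> but not in it. So the stray mass lies in the image at time
  \<open>-s\<close> of the shell \<open>N\<close> around \<open>K\<close>, which has the measure of
  \<open>N\<close>.\<close>

lemma koopman_error_indicator_le:
  assumes n: "n \<ge> 1" and K: "compact K" "K \<subseteq> X" "K \<noteq> {}"
    and C: "C > 0" "\<And>x. norm x \<le> C * nrm x"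
    and L: "L > 0" "\<And>x y. \<lbrakk>x \<in> X; y \<in> X\<rbrakk> \<Longrightarrow> nrm (S s x - S s y) \<le> L * nrm (x - y)"
    and \<delta>: "set_error n K (-s) < \<delta> / (C * L)"
  shows "koopman_error n (indicator K) s \<le> 2 * measure \<mu> ({x \<in> X. infdist x K \<le> \<delta>} - K)"
proof -
  define N where "N = {x \<in> X. infdist x K \<le> \<delta>} - K"
  define D where "D = S (-s) ` K"
  have K_sets: "K \<in> sets \<mu>" using K by (auto simp: in_sets_mu_iff compact_imp_closed)
  have "closed {x \<in> X. infdist x K \<le> \<delta>}"
    using compact_X by (auto simp: compact_imp_closed intro!: closed_Collect_conj closed_Collect_le continuous_intros)
  then have N_sets: "N \<in> sets \<mu>"
    using K by (auto simp: N_def in_sets_mu_iff compact_imp_closed)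
  have D_sets: "D \<in> sets \<mu>" and E_sets: "S (-s) ` N \<in> sets \<mu>"
    unfolding D_def using K_sets N_sets by (auto intro: flow_image_sets)
  have inD: "x \<in> D \<longleftrightarrow> S s x \<in> K" if "x \<in> X" for x
    using flow_vimage[OF K(2), of s] that by (auto simp: D_def)
  have sub: "moved_cell n (-s) p - D \<subseteq> S (-s) ` N" if p: "p \<in> P n" "p \<inter> K \<noteq> {}" for p
  proof
    fix x assume x: "x \<in> moved_cell n (-s) p - D"
    then obtain a where a: "a \<in> K" "nrm (S (-s) a - x) < \<delta> / (C * L)"
      using set_error_lessE[OF n K(2,3) \<delta> p] by blast
    have "moved_cell n (-s) p \<in> P n" using bij_moved_cell[OF n, of "-s"] p by (auto simp: bij_betw_def)
    then have xX: "x \<in> X" using x cell_subset_X[OF n] by blast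
    have aX: "a \<in> X" using a K by blast
    \<comment> \<open>Flowing forward by \<open>s\<close> costs the factor \<open>L\<close>, passing
      to the Euclidean norm the factor \<open>C\<close>; hence the threshold
      \<open>\<delta> / (C * L)\<close>.\<close>
    have "norm (a - S s x) \<le> C * nrm (S s (S (-s) a) - S s x)"
      using C(2) flow_inverse(2)[OF aX] by simp
    also have "\<dots> \<le> C * (L * (\<delta> / (C * L)))"
      using C(1) L(1) a(2) by (intro mult_left_mono order_trans[OF L(2)] flow_into aX xX) auto
    also have "\<dots> = \<delta>" using C(1) L(1) by simp
    finally have "infdist (S s x) K \<le> \<delta>"
      using a(1) by (intro infdist_le2[of a]) (auto simp: dist_norm norm_minus_commute)
    moreover have "S s x \<notin> K" using x inD[OF xX] by blast
    ultimately have "S s x \<in> N" using flow_into[OF xX] by (simp add: N_def)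
    then show "x \<in> S (-s) ` N" using flow_inverse(1)[OF xX, of s] by (metis image_eqI)
  qed
  \<comment> \<open>On \<open>X\<close>, \<open>x \<in> D\<close> holds exactly when
    \<open>S s x \<in> K\<close>, so the Koopman operator sends the indicator of \<open>K\<close> to
    that of \<open>D\<close>.\<close>
  have "koopman_error n (indicator K) s = (L2norm \<mu> (\<lambda>x. indicator D x
     - step_function (P n) (moved_cell n (-s)) (cell_average \<mu> (q n) (indicator K)) x))\<^sup>2"
    unfolding koopman_error_eq[OF n]
    by (intro arg_cong[where f = "\<lambda>r. r\<^sup>2"] L2norm_cong) (simp add: koopman_def space_mu inD indicator_def)
  also have "\<dots> \<le> 2 * measure \<mu> (S (-s) ` N)"
    using measure_flow_image[OF K_sets, of "-s"]
    by (intro equal_partition.L2norm_indicator_step_function_le[OF equal_partition[OF n]]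
        bij_moved_cell n K_sets D_sets E_sets sub) (simp_all add: D_def)
  also have "\<dots> = 2 * measure \<mu> N" by (simp add: measure_flow_image[OF N_sets])
  finally show ?thesis by (simp add: N_def)
qed

text \<open>\<open>C\<close> and \<open>L\<close> serve all times with
  \<open>\<bar>s\<bar> \<le> T\<close>, and the measure of the shell involves neither
  \<open>n\<close> nor \<open>s\<close>, so the single set \<open>K\<close> and one threshold
  suffice.\<close>

lemma controlled_indicator_compact:
  assumes K: "compact K" "K \<subseteq> X" "K \<noteq> {}"
  shows "controlled T (indicator K)"
  unfolding controlled_def
proof (intro conjI allI impI)
  show "square_integrable \<mu> (indicator K)"
    using K by (intro square_integrable_indicator) (auto simp: in_sets_mu_iff compact_imp_closed)
  fix \<epsilon> :: real assume "\<epsilon> > 0"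
  obtain C where C: "C > 0" "\<And>x. norm x \<le> C * nrm x" using norm_le_is_norm[OF norm] by blast
  obtain L where L: "L > 0" "\<And>s s' x y. \<lbrakk>\<bar>s\<bar> \<le> T; \<bar>s'\<bar> \<le> T; x \<in> X; y \<in> X\<rbrakk> \<Longrightarrow>
      nrm (S s x - S s' y) \<le> L * (\<bar>s - s'\<bar> + nrm (x - y))"
    using flow_lipschitzE[of T] by blast
  have "\<forall>\<^sub>F m in sequentially. measure \<mu> ({x \<in> X. infdist x K \<le> 1 / real (Suc m)} - K) < \<epsilon> / 2"
    using \<open>\<epsilon> > 0\<close> by (intro order_tendstoD(2)[OF measure_neighbourhood_tendsto[OF K]]) simp
  then obtain m where m: "measure \<mu> ({x \<in> X. infdist x K \<le> 1 / real (Suc m)} - K) < \<epsilon> / 2"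
    using eventually_happens'[OF sequentially_bot] by blast
  show "\<exists>\<A> \<eta>. finite \<A> \<and> (\<forall>A\<in>\<A>. compact A \<and> A \<subseteq> X \<and> A \<noteq> {}) \<and> \<eta> > 0 \<and>
      (\<forall>n s. n \<ge> 1 \<longrightarrow> \<bar>s\<bar> \<le> T \<longrightarrow> (\<forall>A\<in>\<A>. set_error n A (-s) < \<eta>) \<longrightarrow> koopman_error n (indicator K) s \<le> \<epsilon>)"
  proof (intro exI[of _ "{K}"] exI[of _ "1 / real (Suc m) / (C * L)"] conjI allI impI)
    fix n s assume *: "1 \<le> n" "\<bar>s\<bar> \<le> T" "\<forall>A\<in>{K}. set_error n A (-s) < 1 / real (Suc m) / (C * L)"
    have "nrm (S s x - S s y) \<le> L * nrm (x - y)" if "x \<in> X" "y \<in> X" for x y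
      using L(2)[OF *(2,2) that] by simp
    then have "koopman_error n (indicator K) s \<le> 2 * measure \<mu> ({x \<in> X. infdist x K \<le> 1 / real (Suc m)} - K)"
      using * by (intro koopman_error_indicator_le[OF _ K C L(1)]) auto
    then show "koopman_error n (indicator K) s \<le> \<epsilon>" using m by simp
  qed (use K C(1) L(1) in auto)
qed

lemma controlled_indicator:
  assumes B: "B \<in> sets \<mu>"
  shows "controlled T (indicator B)"
proof (rule controlled_limit)
  show "square_integrable \<mu> (indicator B)" by (rule square_integrable_indicator[OF B])
  fix \<epsilon> :: real assume "\<epsilon> > 0"
  then obtain K where K: "compact K" "K \<subseteq> B" "measure \<mu> (B - K) < \<epsilon>"
    using inner_regular_mu[OF B] by blast
  have K_sets: "K \<in> sets \<mu>" using K B by (auto simp: in_sets_mu_iff compact_imp_closed)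
  have "(L2norm \<mu> (\<lambda>x. indicator B x - indicator K x))\<^sup>2 = (LINT x|\<mu>. indicator (B - K) x)"
    unfolding L2norm_power2 using K
    by (intro Bochner_Integration.integral_cong) (auto simp: indicator_def)
  also have "\<dots> = measure \<mu> (B - K)"
    using sets.sets_into_space[OF B] by (simp add: Int_absorb2 subset_iff)
  also have "\<dots> < \<epsilon>" by (rule K)
  finally have close: "(L2norm \<mu> (\<lambda>x. indicator B x - indicator K x))\<^sup>2 < \<epsilon>" .
  have "controlled T (indicator K)"
  proof (cases "K = {}")
    case True
    \<comment> \<open>\<open>controlled\<close> admits only nonempty sets, so the zero function is
      obtained as a multiple of the indicator of \<open>X\<close>.\<close>
    then have eq: "(indicator K :: _ \<Rightarrow> complex) = (\<lambda>x. 0 * indicator X x)" by auto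
    show ?thesis unfolding eq
      using compact_X X_nonempty by (intro controlled_cmult controlled_indicator_compact) auto
  next
    case False
    then show ?thesis
      using K K_sets by (intro controlled_indicator_compact) (auto simp: in_sets_mu_iff)
  qed
  with close show "\<exists>h. controlled T h \<and> (L2norm \<mu> (\<lambda>x. indicator B x - h x))\<^sup>2 < \<epsilon>" by blast
qed

lemma controlled_simple_function:
  assumes "simple_function \<mu> f"
  shows "controlled T f"
  using assms
proof (rule integrable_simple_function_induct)
  show "emeasure \<mu> {y \<in> space \<mu>. f y \<noteq> 0} \<noteq> \<infinity>" by (simp add: emeasure_eq_measure)
next
  \<comment> \<open>The two functions agree on \<open>X\<close> alone, but their
    \<open>L2norm\<close> distance is 0, so \<open>controlled_limit\<close> applies.\<close>
  fix f g assume "simple_function \<mu> g" and f: "controlled T f" and eq: "\<And>x. x \<in> space \<mu> \<Longrightarrow> f x = g x"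
  show "controlled T g"
  proof (rule controlled_limit)
    show "square_integrable \<mu> g" using \<open>simple_function \<mu> g\<close> by (rule square_integrable_simple_function)
    have "L2norm \<mu> (\<lambda>x. g x - f x) = L2norm \<mu> (\<lambda>x. 0)" using eq by (intro L2norm_cong) simp
    then show "\<exists>h. controlled T h \<and> (L2norm \<mu> (\<lambda>x. g x - h x))\<^sup>2 < \<epsilon>" if "\<epsilon> > 0" for \<epsilon>
      using f that by (auto simp: L2norm_def)
  qed
next
  fix A and y :: complex assume "A \<in> sets \<mu>"
  then have "controlled T (\<lambda>x. y * indicator A x)" by (intro controlled_cmult controlled_indicator)
  also have "(\<lambda>x. y * indicator A x) = (\<lambda>x. indicator A x *\<^sub>R y)" by (auto simp: indicator_def)
  finally show "controlled T (\<lambda>x. indicator A x *\<^sub>R y)" .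
qed (rule controlled_add)

lemma controlled_L2:
  assumes g: "square_integrable \<mu> g"
  shows "controlled T g"
proof (rule controlled_limit[OF g])
  fix \<epsilon> :: real assume "\<epsilon> > 0"
  have [measurable]: "g \<in> borel_measurable \<mu>" using g by (simp add: square_integrable_def)
  obtain f where f: "\<And>i. simple_function \<mu> (f i)" "\<And>x. x \<in> space \<mu> \<Longrightarrow> (\<lambda>i. f i x) \<longlonglongrightarrow> g x"
    "\<And>i x. x \<in> space \<mu> \<Longrightarrow> cmod (f i x) \<le> 2 * cmod (g x)"
    using borel_measurable_implies_sequence_metric[OF \<open>g \<in> borel_measurable \<mu>\<close>, of 0]
    by (simp add: dist_norm) metis
  have [measurable]: "f i \<in> borel_measurable \<mu>" for i using borel_measurable_simple_function[OF f(1)] .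
  \<comment> \<open>The approximants are bounded by twice \<open>cmod (g x)\<close>, so the
    difference is at most three times it; hence the factor 9 in the dominating function.\<close>
  have "(\<lambda>i. LINT x|\<mu>. (cmod (g x - f i x))\<^sup>2) \<longlonglongrightarrow> (LINT x|\<mu>. 0)"
  proof (rule integral_dominated_convergence[where w = "\<lambda>x. 9 * (cmod (g x))\<^sup>2"])
    show "integrable \<mu> (\<lambda>x. 9 * (cmod (g x))\<^sup>2)" using g by (simp add: square_integrable_def)
    show "AE x in \<mu>. (\<lambda>i. (cmod (g x - f i x))\<^sup>2) \<longlonglongrightarrow> 0"
    proof (rule AE_I2)
      fix x assume "x \<in> space \<mu>"
      then have "(\<lambda>i. (cmod (g x - f i x))\<^sup>2) \<longlonglongrightarrow> (cmod (g x - g x))\<^sup>2"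
        by (intro tendsto_intros f)
      then show "(\<lambda>i. (cmod (g x - f i x))\<^sup>2) \<longlonglongrightarrow> 0" by simp
    qed
    show "AE x in \<mu>. norm ((cmod (g x - f i x))\<^sup>2) \<le> 9 * (cmod (g x))\<^sup>2" for i
    proof (rule AE_I2)
      fix x assume "x \<in> space \<mu>"
      then have "cmod (g x - f i x) \<le> 3 * cmod (g x)"
        using f(3)[of x i] norm_triangle_ineq4[of "g x" "f i x"] by simp
      then have "(cmod (g x - f i x))\<^sup>2 \<le> (3 * cmod (g x))\<^sup>2" by (intro power_mono) auto
      then show "norm ((cmod (g x - f i x))\<^sup>2) \<le> 9 * (cmod (g x))\<^sup>2" by (simp add: power_mult_distrib)
    qed
  qed measurable
  then have "(\<lambda>i. (L2norm \<mu> (\<lambda>x. g x - f i x))\<^sup>2) \<longlonglongrightarrow> 0" by (simp add: L2norm_power2)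
  then have "\<forall>\<^sub>F i in sequentially. (L2norm \<mu> (\<lambda>x. g x - f i x))\<^sup>2 < \<epsilon>"
    using \<open>\<epsilon> > 0\<close> by (rule order_tendstoD)
  then obtain i where "(L2norm \<mu> (\<lambda>x. g x - f i x))\<^sup>2 < \<epsilon>"
    using eventually_happens'[OF sequentially_bot] by blast
  with controlled_simple_function[OF f(1)]
  show "\<exists>h. controlled T h \<and> (L2norm \<mu> (\<lambda>x. g x - h x))\<^sup>2 < \<epsilon>" by blast
qed

section \<open>Integration over time\<close>

text \<open>Only an upper bound for \<^const>\<open>koopman_error\<close> has to be integrable in time: the integral of
  a function that is not integrable is \<open>0\<close>.\<close>

lemma integral_koopman_error_le:
  assumes n: "n \<ge> 1" and T: "0 \<le> T" and g: "square_integrable \<mu> g" and \<eta>: "\<eta> > 0"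
    and fin: "finite \<A>" and \<A>: "\<And>A. A \<in> \<A> \<Longrightarrow> A \<subseteq> X \<and> A \<noteq> {}" and \<epsilon>: "\<epsilon> > 0"
    and le: "\<And>s. \<lbrakk>\<bar>s\<bar> \<le> T; \<And>A. A \<in> \<A> \<Longrightarrow> set_error n A (-s) < \<eta>\<rbrakk> \<Longrightarrow> koopman_error n g s \<le> \<epsilon>"
  shows "(LBINT s=ereal (-T)..ereal T. koopman_error n g s) \<le>
    2 * T * \<epsilon> + 4 * (L2norm \<mu> g)\<^sup>2 / \<eta> * (\<Sum>A\<in>\<A>. LBINT s=ereal (-T)..ereal T. set_error n A s)"
proof -
  obtain M where M: "\<And>x y. \<lbrakk>x \<in> X; y \<in> X\<rbrakk> \<Longrightarrow> nrm (x - y) \<le> M" using bounded_diameter by blast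
  \<comment> \<open>A Markov-type majorant: \<open>c * \<eta>\<close> is the bound of
    \<open>koopman_error_le\<close>, so once some set error reaches \<open>\<eta>\<close>, its term
    in \<open>b\<close> already dominates. At all other times \<open>\<epsilon>\<close>
    does.\<close>
  define c where "c = 4 * (L2norm \<mu> g)\<^sup>2 / \<eta>"
  have c: "c \<ge> 0" using \<eta> by (simp add: c_def)
  define b where "b s = \<epsilon> + c * (\<Sum>A\<in>\<A>. set_error n A (-s))" for s
  have nonneg: "0 \<le> set_error n A s" if "A \<in> \<A>" for A s
    using set_error_bounds(1)[OF n _ _ M] \<A>[OF that] by blast
  have b_nonneg: "0 \<le> b s" for s
    using nonneg c \<epsilon> by (auto simp: b_def intro!: add_nonneg_nonneg mult_nonneg_nonneg sum_nonneg)
  have bound: "koopman_error n g s \<le> b s" if "\<bar>s\<bar> \<le> T" for s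
  proof (cases "\<forall>A\<in>\<A>. set_error n A (-s) < \<eta>")
    case True
    then have "koopman_error n g s \<le> \<epsilon>" using le that by blast
    also have "\<epsilon> \<le> b s" using nonneg c by (auto simp: b_def intro!: mult_nonneg_nonneg sum_nonneg)
    finally show ?thesis .
  next
    case False
    then obtain A where A: "A \<in> \<A>" "\<eta> \<le> set_error n A (-s)" by force
    have "koopman_error n g s \<le> c * \<eta>"
      using koopman_error_le[OF n g, of s] \<eta> by (simp add: c_def)
    also have "\<dots> \<le> c * (\<Sum>A\<in>\<A>. set_error n A (-s))"
      using nonneg A fin member_le_sum[of A \<A> "\<lambda>A. set_error n A (-s)"]
      by (intro mult_left_mono c) auto
    also have "\<dots> \<le> b s" using \<epsilon> by (simp add: b_def)
    finally show ?thesis .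
  qed
  have int: "interval_lebesgue_integrable lborel (ereal (-T)) (ereal T) (\<lambda>s. set_error n A (-s))" if "A \<in> \<A>" for A
    using set_error_integrable[OF n _ _ T] \<A>[OF that] by (simp add: interval_integrable_mirror)
  have int_sum: "interval_lebesgue_integrable lborel (ereal (-T)) (ereal T) (\<lambda>s. \<Sum>A\<in>\<A>. set_error n A (-s))"
    using int T unfolding interval_lebesgue_integrable_def set_integrable_def scaleR_sum_right
    by (auto split: if_splits intro!: Bochner_Integration.integrable_sum)
  have int_const: "interval_lebesgue_integrable lborel (ereal (-T)) (ereal T) (\<lambda>s. \<epsilon>)"
    by (rule interval_integrable_isCont) simp
  have int_b: "interval_lebesgue_integrable lborel (ereal (-T)) (ereal T) b"
    unfolding b_def[abs_def] using int_const int_sum by simp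
  have "(LBINT s=ereal (-T)..ereal T. koopman_error n g s) \<le> (LBINT s=ereal (-T)..ereal T. b s)"
    using T int_b b_nonneg bound
    unfolding interval_lebesgue_integral_def interval_lebesgue_integrable_def
      set_lebesgue_integral_def set_integrable_def
    by (auto intro!: integral_mono' simp: einterval_eq indicator_def)
  also have "\<dots> = 2 * T * \<epsilon> + c * (LBINT s=ereal (-T)..ereal T. (\<Sum>A\<in>\<A>. set_error n A (-s)))"
    unfolding b_def[abs_def] using int_const int_sum T by simp
  also have "(LBINT s=ereal (-T)..ereal T. (\<Sum>A\<in>\<A>. set_error n A (-s))) =
      (\<Sum>A\<in>\<A>. LBINT s=ereal (-T)..ereal T. set_error n A (-s))"
    using int T by (simp add: interval_lebesgue_integral_def interval_lebesgue_integrable_def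
        set_lebesgue_integral_def set_integrable_def sum_distrib_left)
  \<comment> \<open>The interval is symmetric, so replacing \<open>s\<close> by \<open>-s\<close>
    leads back to the integrals of periodic approximation.\<close>
  also have "\<dots> = (\<Sum>A\<in>\<A>. LBINT s=ereal (-T)..ereal T. set_error n A s)"
    by (intro sum.cong refl, subst interval_integral_reflect) simp
  finally show ?thesis by (simp add: c_def)
qed

lemma integral_koopman_error_tendsto:
  assumes approx: "periodically_approximates (norm_metric nrm) X S \<tau> P F"
    and g: "square_integrable \<mu> g" and T: "0 \<le> T"
  shows "(\<lambda>n. LBINT s=ereal (-T)..ereal T. koopman_error n g s) \<longlonglongrightarrow> 0"
proof (rule order_tendstoI)
  fix a :: real assume "a < 0"
  have "0 \<le> (LBINT s=ereal (-T)..ereal T. koopman_error n g s)" for n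
    using T koopman_error_nonneg
    by (simp add: interval_lebesgue_integral_def set_lebesgue_integral_def)
  with \<open>a < 0\<close> show "\<forall>\<^sub>F n in sequentially. a < (LBINT s=ereal (-T)..ereal T. koopman_error n g s)"
    by (intro always_eventually allI) (meson less_le_trans)
next
  fix a :: real assume "0 < a"
  \<comment> \<open>\<open>2 * T\<close> is the length of the interval; the added 1 covers
    \<open>T = 0\<close> and leaves strict room below \<open>a\<close> for the set errors.\<close>
  define \<epsilon> where "\<epsilon> = a / (2 * T + 1)"
  have \<epsilon>: "\<epsilon> > 0" using \<open>0 < a\<close> T by (simp add: \<epsilon>_def)
  have "2 * T * \<epsilon> < (2 * T + 1) * \<epsilon>" using \<epsilon> by (simp add: algebra_simps)
  also have "\<dots> = a" using T by (simp add: \<epsilon>_def)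
  finally have small: "2 * T * \<epsilon> < a" .
  obtain \<A> \<eta> where A: "finite \<A>" "\<And>A. A \<in> \<A> \<Longrightarrow> compact A \<and> A \<subseteq> X \<and> A \<noteq> {}" "\<eta> > 0"
    "\<And>n s. \<lbrakk>n \<ge> 1; \<bar>s\<bar> \<le> T; \<And>A. A \<in> \<A> \<Longrightarrow> set_error n A (-s) < \<eta>\<rbrakk> \<Longrightarrow> koopman_error n g s \<le> \<epsilon>"
    using controlledE[OF controlled_L2[OF g, of T] \<epsilon>] by blast
  have "(\<lambda>n. LBINT s=ereal (-T)..ereal T. set_error n A s) \<longlonglongrightarrow> 0" if "A \<in> \<A>" for A
    using approx A(2)[OF that] by (simp add: periodically_approximates_def set_error_def)
  then have "(\<lambda>n. 2 * T * \<epsilon> + 4 * (L2norm \<mu> g)\<^sup>2 / \<eta> *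
      (\<Sum>A\<in>\<A>. LBINT s=ereal (-T)..ereal T. set_error n A s)) \<longlonglongrightarrow> 2 * T * \<epsilon> + 4 * (L2norm \<mu> g)\<^sup>2 / \<eta> * (\<Sum>A\<in>\<A>. 0)"
    by (intro tendsto_intros)
  then have "\<forall>\<^sub>F n in sequentially. 2 * T * \<epsilon> + 4 * (L2norm \<mu> g)\<^sup>2 / \<eta> *
      (\<Sum>A\<in>\<A>. LBINT s=ereal (-T)..ereal T. set_error n A s) < a"
    using small by (intro order_tendstoD(2)) auto
  then show "\<forall>\<^sub>F n in sequentially. (LBINT s=ereal (-T)..ereal T. koopman_error n g s) < a"
    using eventually_ge_at_top[of 1]
  proof eventually_elim
    case (elim n)
    then show ?case
      using integral_koopman_error_le[OF elim(2) T g A(3,1) _ \<epsilon> A(4)] A(2) by fastforce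
  qed
qed

end

theorem theorem4p2:
  fixes \<mu> :: "(real ^ 'n) measure"
    and nrm :: "real ^ 'n \<Rightarrow> real"
    and X :: "(real ^ 'n) set"
    and S :: "real \<Rightarrow> real ^ 'n \<Rightarrow> real ^ 'n"
    and \<tau> l :: "nat \<Rightarrow> real"
    and P :: "nat \<Rightarrow> (real ^ 'n) set set"
    and q :: "nat \<Rightarrow> nat"
    and F :: "nat \<Rightarrow> (real ^ 'n) set \<Rightarrow> (real ^ 'n) set"
    and g :: "real ^ 'n \<Rightarrow> complex"
    and t :: real
  assumes "measure_preserving_flow \<mu> nrm X S"
    and "time_steps \<tau>"
    and "partition_sequence (norm_metric nrm) \<mu> P q l"
    and "\<And>n. n \<ge> 1 \<Longrightarrow> bij_betw (F n) (P n) (P n)"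
    and "periodically_approximates (norm_metric nrm) X S \<tau> P F"
    and "square_integrable \<mu> g"
  shows "(\<lambda>n. LBINT s=ereal (-t)..ereal t.
            (L2norm \<mu> (\<lambda>x. koopman S s g x
               - discrete_koopman \<mu> (P n) (F n) (q n) (xi_steps (\<tau> n) s)
                   (averaging \<mu> (P n) (q n) g) x))\<^sup>2)
         \<longlonglongrightarrow> 0"
proof -
  interpret discretised_flow \<mu> nrm X S P q l \<tau> F
    using assms(1-4) by (simp add: discretised_flow_def discretised_flow_axioms_def)
  have "(\<lambda>n. LBINT s=ereal (-t)..ereal t. koopman_error n g s) \<longlonglongrightarrow> 0"
  proof (cases "0 \<le> t")
    case True
    then show ?thesis using assms(5,6) by (intro integral_koopman_error_tendsto)
  next
    case False
    \<comment> \<open>For negative \<open>t\<close> the integral is oriented: exchanging the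
      endpoints changes its sign and reduces to \<open>-t\<close>.\<close>
    then have "(\<lambda>n. - (LBINT s=ereal (- (-t))..ereal (-t). koopman_error n g s)) \<longlonglongrightarrow> - 0"
      using assms(5,6) by (intro tendsto_minus integral_koopman_error_tendsto) auto
    then show ?thesis
      by (subst interval_integral_endpoints_reverse) simp
  qed
  then show ?thesis by (simp add: koopman_error_def)
qed

end
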